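(* Consider a binary-response generalized linear mixed model with link $F^{-1}$, where $F$ is a cumulative distribution function on $\mathbb{R}$: given $\bm\beta\in\mathbb{R}^p$ and $\bm u=(\bm u_1^T,\dots,\bm u_r^T)^T\in\mathbb{R}^q$ ($\bm u_j\in\mathbb{R}^{q_j}$, $q=q_1+\dots+q_r$), the responses $Y_1,\dots,Y_n$ are independent with $P(Y_i=1)=F(\bm x_i^T\bm\beta+\bm z_i^T\bm u)$, and $\bm u_j\overset{ind}{\sim}N(\bm 0,\tau_j^{-1}\bm I_{q_j})$. Put the improper prior $\pi(\bm\beta)\propto 1$ and independent priors $\pi(\tau_j)\propto e^{-b_j\tau_j}\tau_j^{a_j-1}$ on $\tau_j>0$, $j=1,\dots,r$. Assume the design structure described in the context, and suppose: (B1) for each $j=1,\dots,r$, either ($a_j<0$, $b_j=0$ and $q_j\ge 2$) or $b_j>0$; (B2) $2a_j+q_j-1>0$ for $j=1,\dots,r$; (B3) $\tilde{\bm W}$ has full column rank; (B4) there exists a vector $\bm e\in\mathbb{R}^n$ with all entries strictly positive such that $\bm e^T\tilde{\bm W}^*=\bm 0$; (B5) $E|\delta|^{p+t}<\infty$ where $\delta\sim F$ and $t=\sum_{j=1}^r[-2a_j I(b_j=0)+(q_j-1)I(b_j>0)]$. Then for the observed $\bm y=(y_1,\dots,y_n)\in\{0,1\}^n$, $$\int_{\mathbb{R}_+^r}\int_{\mathbb{R}^q}\int_{\mathbb{R}^p}\prod_{i=1}^n[F(\bm x_i^T\bm\beta+\bm z_i^T\bm u)]^{y_i}[1-F(\bm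 x_i^T\bm\beta+\bm z_i^T\bm u)]^{1-y_i}\prod_{j=1}^r\tau_j^{q_j/2+a_j-1}\exp\Big[-\tau_j\Big(b_j+\tfrac12\bm u_j^T\bm u_j\Big)\Big]\,d\bm\beta\,d\bm u\,d\bm\tau<\infty,$$ i.e. the joint posterior density of $(\bm\beta,\bm\tau)$ is proper.
   Context: Data: $\bm y=(y_1,\dots,y_n)^T\in\{0,1\}^n$; $\bm x_i\in\mathbb{R}^p$, $\bm z_i\in\mathbb{R}^q$ are known; $\bm X$ is the $n\times p$ matrix with rows $\bm x_i^T$, $\bm Z$ the $n\times q$ matrix with rows $\bm z_i^T$. Design structure: the first column of $\bm X$ is the all-ones vector (intercept $\beta_0$ in $\bm\beta=(\beta_0,\dots,\beta_{p-1})^T$); $\bm Z=(\bm Z_1,\dots,\bm Z_r)$ where $\bm Z_j$ is $n\times q_j$ with $(i,k)$ entry equal to 1 if observation $i$ is at level $k$ of the $j$th random effect $\bm u_j=(u_{j1},\dots,u_{jq_j})^T$ and 0 otherwise (each observation is at exactly one level of each random effect). $\tilde{\bm Z}_j$ is $\bm Z_j$ with its first column deleted, $\tilde{\bm Z}=(\tilde{\bm Z}_1,\dots,\tilde{\bm Z}_r)$, and $\tilde{\bm W}=(\bm X,\tilde{\bm Z})$ with $i$th row $\tilde{\bm w}_i^T$. Let $c_i=1-2y_i$ (so $c_i=1$ if $y_i=0$ and $c_i=-1$ if $y_i=1$); $\tilde{\bm W}^*$ is the matrix whose $i$th row is $c_i\tilde{\bm w}_i^T$. $\mathbb{R}_+=(0,\infty)$.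 *)

theory Defs
  imports "HOL-Probability.Probability"
begin

text \<open>Encoding of the design.
  Observations are indexed by i < n, fixed-effect covariates by k < p,
  random effects by j < r, and levels of random effect j by k < q j.
  x i k is the (i,k) entry of X (with x i 0 = 1, the intercept column).
  lev j i < q j is the level of the j-th random effect at which observation i sits;
  hence the (i,k) entry of Z_j is 1 iff lev j i = k, and z_i^T u = sum_j u(j, lev j i).
  u is indexed by pairs (j,k) with j < r and k < q j.\<close>

definition lin_pred ::
  "nat \<Rightarrow> nat \<Rightarrow> (nat \<Rightarrow> nat \<Rightarrow> real) \<Rightarrow> (nat \<Rightarrow> nat \<Rightarrow> nat)
   \<Rightarrow> nat \<Rightarrow> (nat \<Rightarrow> real) \<Rightarrow> (nat \<times> nat \<Rightarrow> real) \<Rightarrow> real" where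
  "lin_pred p r x lev i \<beta> u = (\<Sum>k<p. x i k * \<beta> k) + (\<Sum>j<r. u (j, lev j i))"

text \<open>Columns of W~ = (X, Z~_1, ..., Z~_r): Inl k for column k of X (k < p),
  Inr (j,k) for column k of Z_j with 1 \<le> k < q j (the first column k = 0 deleted).\<close>

definition Wt_cols :: "nat \<Rightarrow> nat \<Rightarrow> (nat \<Rightarrow> nat) \<Rightarrow> (nat + nat \<times> nat) set" where
  "Wt_cols p r q = Inl ` {..<p} \<union> Inr ` (SIGMA j:{..<r}. {1..<q j})"

definition Wt :: "(nat \<Rightarrow> nat \<Rightarrow> real) \<Rightarrow> (nat \<Rightarrow> nat \<Rightarrow> nat) \<Rightarrow> nat \<Rightarrow> nat + nat \<times> nat \<Rightarrow> real" where
  "Wt x lev i c = (case c of Inl k \<Rightarrow> x i k | Inr (j, k) \<Rightarrow> (if lev j i = k then 1 else 0))"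

definition Wt_star :: "(nat \<Rightarrow> nat \<Rightarrow> real) \<Rightarrow> (nat \<Rightarrow> nat \<Rightarrow> nat) \<Rightarrow> (nat \<Rightarrow> nat) \<Rightarrow> nat \<Rightarrow> nat + nat \<times> nat \<Rightarrow> real" where
  "Wt_star x lev y i c = (1 - 2 * real (y i)) * Wt x lev i c"

definition full_column_rank :: "nat \<Rightarrow> 'c set \<Rightarrow> (nat \<Rightarrow> 'c \<Rightarrow> real) \<Rightarrow> bool" where
  "full_column_rank n C A \<longleftrightarrow>
     (\<forall>\<gamma>. (\<forall>i<n. (\<Sum>c\<in>C. A i c * \<gamma> c) = 0) \<longrightarrow> (\<forall>c\<in>C. \<gamma> c = 0))"

definition post_integrand ::
  "real measure \<Rightarrow> nat \<Rightarrow> nat \<Rightarrow> nat \<Rightarrow> (nat \<Rightarrow> nat) \<Rightarrow> (nat \<Rightarrow> nat \<Rightarrow> real)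
   \<Rightarrow> (nat \<Rightarrow> nat \<Rightarrow> nat) \<Rightarrow> (nat \<Rightarrow> nat) \<Rightarrow> (nat \<Rightarrow> real) \<Rightarrow> (nat \<Rightarrow> real)
   \<Rightarrow> (nat \<Rightarrow> real) \<Rightarrow> (nat \<times> nat \<Rightarrow> real) \<Rightarrow> (nat \<Rightarrow> real) \<Rightarrow> real" where
  "post_integrand M n p r q x lev y a b \<beta> u \<tau> =
     (\<Prod>i<n. cdf M (lin_pred p r x lev i \<beta> u) ^ y i
              * (1 - cdf M (lin_pred p r x lev i \<beta> u)) ^ (1 - y i))
   * (\<Prod>j<r. \<tau> j powr (real (q j) / 2 + a j - 1)
              * exp (- \<tau> j * (b j + (1/2) * (\<Sum>k<q j. (u (j, k))\<^sup>2))))"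

end

theory Submission
  imports Defs
begin

text \<open>
  Absorbing the first level of every random effect into the intercept writes the linear predictor
  as the product of the matrix W~ with a reduced coefficient vector, whose entries are the
  intercept plus the sum of the u(j,0), the other fixed effects, and the differences
  u(j,k) - u(j,0). By (B3) and (B4) some observation i has a signed predictor
  c_i w~_i^T \<theta> that dominates every entry of the reduced vector \<theta> up to a constant K.
  The i-th factor alone then bounds the likelihood by the probability that all entries of \<theta>
  are at most K|\<delta>|, where \<delta> has distribution F. Integrating over \<delta> last, the fixed effects
  contribute (2K|\<delta>|)^p, and since |u_j|^2 dominates u(j,0)^2 and the squared differences, the
  remaining integral splits over j into one-dimensional ones of order |\<delta>|^t_j, where t_j is the
  j-th summand of t. Condition (B5) then makes the integral over \<delta> finite.
\<close>

section \<open>Linear algebra of the design matrix\<close>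

text \<open>An injective linear map between finite-dimensional spaces is bounded below. The
  induction on the columns is Gaussian elimination: a pivot row clears column \<open>c0\<close>, the
  remaining matrix keeps full column rank, and the constant is carried back explicitly.\<close>

lemma full_column_rank_bound:
  fixes A :: "nat \<Rightarrow> 'c \<Rightarrow> real"
  assumes "finite C" "full_column_rank n C A"
  shows "\<exists>K\<ge>0. \<forall>\<gamma>. \<forall>c\<in>C. \<bar>\<gamma> c\<bar> \<le> K * (\<Sum>i<n. \<bar>\<Sum>c\<in>C. A i c * \<gamma> c\<bar>)"
  using assms
proof (induction C arbitrary: A rule: finite_induct)
  case empty
  show ?case by (auto intro: exI[of _ 0])
next
  case (insert c0 C)
  have rank: "\<gamma> c = 0" if "\<And>i. i < n \<Longrightarrow> A i c0 * \<gamma> c0 + (\<Sum>c\<in>C. A i c * \<gamma> c) = 0" "c \<in> insert c0 C" for \<gamma> c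
    using insert.prems[unfolded full_column_rank_def, THEN spec, of \<gamma>] insert.hyps that by auto
  \<comment> \<open>If column \<open>c0\<close> vanished, its unit vector would be a nonzero element
    of the kernel; hence a pivot exists.\<close>
  have "\<exists>i0<n. A i0 c0 \<noteq> 0"
  proof (rule ccontr)
    assume "\<not> ?thesis"
    then have "(\<lambda>c. if c = c0 then 1 else 0 :: real) c0 = 0"
      using insert.hyps by (intro rank[of "\<lambda>c. if c = c0 then 1 else 0" c0]) (auto intro!: sum.neutral)
    then show False by simp
  qed
  then obtain i0 where i0: "i0 < n" "A i0 c0 \<noteq> 0" by blast
  \<comment> \<open>\<open>m i\<close> is the multiple of the pivot row \<open>i0\<close> that is
    subtracted from row \<open>i\<close> to clear column \<open>c0\<close>; \<open>A'\<close> is the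
    matrix after this elimination.\<close>
  define m where "m i = A i c0 / A i0 c0" for i
  define A' where "A' i c = A i c - m i * A i0 c" for i c
  have A'_sum: "(\<Sum>c\<in>C. A' i c * \<gamma> c) = (\<Sum>c\<in>C. A i c * \<gamma> c) - m i * (\<Sum>c\<in>C. A i0 c * \<gamma> c)" for i \<gamma>
    by (simp add: A'_def left_diff_distrib sum_subtractf sum_distrib_left mult.assoc)
  have "full_column_rank n C A'"
    unfolding full_column_rank_def
  proof (intro allI impI ballI)
    fix \<gamma> c assume z: "\<forall>i<n. (\<Sum>c\<in>C. A' i c * \<gamma> c) = 0" and c: "c \<in> C"
    \<comment> \<open>The new entry at \<open>c0\<close> solves the pivot row, so that a kernel
      vector of \<open>A'\<close> extends to a kernel vector of \<open>A\<close>.\<close>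
    let ?g = "\<gamma>(c0 := - (\<Sum>c\<in>C. A i0 c * \<gamma> c) / A i0 c0)"
    have g: "(\<Sum>c\<in>C. A i c * ?g c) = (\<Sum>c\<in>C. A i c * \<gamma> c)" for i
      using insert.hyps by (intro sum.cong) auto
    have "?g c = 0"
    proof (rule rank[of ?g c])
      fix i assume "i < n"
      then have "(\<Sum>c\<in>C. A' i c * \<gamma> c) = 0"
        using z by blast
      then have "(\<Sum>c\<in>C. A i c * \<gamma> c) = m i * (\<Sum>c\<in>C. A i0 c * \<gamma> c)"
        unfolding A'_sum by linarith
      then show "A i c0 * ?g c0 + (\<Sum>c\<in>C. A i c * ?g c) = 0"
        unfolding g by (simp add: m_def)
    qed (use c in simp)
    then show "\<gamma> c = 0" using c insert.hyps by (auto split: if_splits)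
  qed
  from insert.IH[OF this] obtain K where K: "K \<ge> 0"
    "\<And>\<gamma> c. c \<in> C \<Longrightarrow> \<bar>\<gamma> c\<bar> \<le> K * (\<Sum>i<n. \<bar>\<Sum>c\<in>C. A' i c * \<gamma> c\<bar>)" by blast
  \<comment> \<open>\<open>K1\<close> serves the columns in \<open>C\<close>: the product of a
    vector with row \<open>i\<close> of \<open>A'\<close> is that with row \<open>i\<close> of
    \<open>A\<close> minus \<open>m i\<close> times that with the pivot row. \<open>K2\<close>
    serves \<open>c0\<close>: the pivot row is solved for this entry and the other entries are
    estimated by \<open>K1\<close>.\<close>
  define K1 where "K1 = K * (\<Sum>i<n. 1 + \<bar>m i\<bar>)"
  define K2 where "K2 = (1 + (\<Sum>c\<in>C. \<bar>A i0 c\<bar>) * K1) / \<bar>A i0 c0\<bar>"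
  have K1: "K1 \<ge> 0" unfolding K1_def using K by (intro mult_nonneg_nonneg sum_nonneg) auto
  have K2: "K2 \<ge> 0" unfolding K2_def using K1
    by (intro divide_nonneg_nonneg add_nonneg_nonneg mult_nonneg_nonneg sum_nonneg) auto
  show ?case
  proof (intro exI[of _ "max K1 K2"] conjI allI ballI)
    show "0 \<le> max K1 K2" using K1 by simp
    fix \<gamma> c assume c: "c \<in> insert c0 C"
    define s where "s i = (\<Sum>c\<in>insert c0 C. A i c * \<gamma> c)" for i
    define S where "S = (\<Sum>i<n. \<bar>s i\<bar>)"
    have S: "S \<ge> 0" by (simp add: S_def sum_nonneg)
    have sS: "\<bar>s i\<bar> \<le> S" if "i < n" for i
      unfolding S_def using that by (intro member_le_sum) auto
    have s: "s i = A i c0 * \<gamma> c0 + (\<Sum>c\<in>C. A i c * \<gamma> c)" for i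
      unfolding s_def using insert.hyps by simp
    have "(\<Sum>c\<in>C. A' i c * \<gamma> c) = s i - m i * s i0" for i
      unfolding A'_sum s using i0 by (simp add: m_def field_simps)
    then have "(\<Sum>i<n. \<bar>\<Sum>c\<in>C. A' i c * \<gamma> c\<bar>) \<le> (\<Sum>i<n. (1 + \<bar>m i\<bar>) * S)"
    proof (intro sum_mono, simp)
      fix i assume "i < n"
      have "\<bar>s i - m i * s i0\<bar> \<le> \<bar>s i\<bar> + \<bar>m i\<bar> * \<bar>s i0\<bar>"
        by (metis abs_triangle_ineq4 abs_mult)
      also have "\<dots> \<le> S + \<bar>m i\<bar> * S"
        using sS \<open>i < n\<close> i0 by (intro add_mono mult_left_mono) auto
      finally show "\<bar>s i - m i * s i0\<bar> \<le> (1 + \<bar>m i\<bar>) * S" by (simp add: algebra_simps)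
    qed
    then have bC: "\<bar>\<gamma> c\<bar> \<le> K1 * S" if "c \<in> C" for c
      using order.trans[OF K(2)[OF that, of \<gamma>] mult_left_mono[OF _ K(1)]]
      by (simp add: K1_def sum_distrib_right mult.assoc)
    have "\<bar>\<Sum>c\<in>C. A i0 c * \<gamma> c\<bar> \<le> (\<Sum>c\<in>C. \<bar>A i0 c\<bar> * (K1 * S))"
      by (rule order.trans[OF sum_abs])
         (auto intro!: sum_mono mult_left_mono bC simp: abs_mult)
    moreover have "A i0 c0 * \<gamma> c0 = s i0 - (\<Sum>c\<in>C. A i0 c * \<gamma> c)" using s[of i0] by simp
    then have "\<bar>A i0 c0\<bar> * \<bar>\<gamma> c0\<bar> \<le> \<bar>s i0\<bar> + \<bar>\<Sum>c\<in>C. A i0 c * \<gamma> c\<bar>"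
      by (metis abs_mult abs_triangle_ineq4)
    ultimately have "\<bar>A i0 c0\<bar> * \<bar>\<gamma> c0\<bar> \<le> S + (\<Sum>c\<in>C. \<bar>A i0 c\<bar>) * (K1 * S)"
      using sS[OF i0(1)] by (simp add: sum_distrib_right)
    then have "\<bar>\<gamma> c0\<bar> \<le> K2 * S"
      using i0 by (simp add: K2_def field_simps)
    moreover have "K1 * S \<le> max K1 K2 * S" "K2 * S \<le> max K1 K2 * S"
      using S by (auto intro!: mult_right_mono)
    ultimately have "\<bar>\<gamma> c\<bar> \<le> max K1 K2 * S"
      using bC c by force
    then show "\<bar>\<gamma> c\<bar> \<le> max K1 K2 * (\<Sum>i<n. \<bar>\<Sum>c\<in>insert c0 C. A i c * \<gamma> c\<bar>)"
      by (simp add: S_def s_def)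
  qed
qed

text \<open>The weights \<open>e\<close> make the signed predictors average to zero, so their
  maximum is nonnegative, and a very negative value forces a large positive one. The row with the
  largest signed predictor therefore controls all rows and, by
  \<open>full_column_rank_bound\<close>, all coefficients. The constant is uniform; only the row
  depends on \<open>\<gamma>\<close>.\<close>

lemma exists_row_controlling_coefficients:
  fixes A :: "nat \<Rightarrow> 'c \<Rightarrow> real" and \<sigma> e :: "nat \<Rightarrow> real"
  assumes C: "finite C" "C \<noteq> {}"
    and rank: "full_column_rank n C A"
    and sgn: "\<And>i. i < n \<Longrightarrow> \<bar>\<sigma> i\<bar> = 1"
    and e: "\<And>i. i < n \<Longrightarrow> 0 < e i"
    and bal: "\<And>c. c \<in> C \<Longrightarrow> (\<Sum>i<n. e i * (\<sigma> i * A i c)) = 0"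
  shows "\<exists>K>0. \<forall>\<gamma>. \<exists>i<n. 0 \<le> \<sigma> i * (\<Sum>c\<in>C. A i c * \<gamma> c) \<and>
           (\<forall>c\<in>C. \<bar>\<gamma> c\<bar> \<le> K * (\<sigma> i * (\<Sum>c\<in>C. A i c * \<gamma> c)))"
proof -
  \<comment> \<open>Without rows the all-ones vector would lie in the kernel, and \<open>C\<close>
    is nonempty. A positive \<open>n\<close> is what allows a maximal row to be chosen.\<close>
  have n: "0 < n"
  proof (rule ccontr)
    assume "\<not> 0 < n"
    then have "\<forall>\<gamma> :: 'c \<Rightarrow> real. \<forall>c\<in>C. \<gamma> c = 0"
      using rank unfolding full_column_rank_def by simp
    then have "\<forall>c\<in>C. (1::real) = 0" by (rule spec[of _ "\<lambda>_. 1"])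
    then show False using C by simp
  qed
  obtain K where K: "K \<ge> 0"
    "\<And>\<gamma> c. c \<in> C \<Longrightarrow> \<bar>\<gamma> c\<bar> \<le> K * (\<Sum>i<n. \<bar>\<Sum>c\<in>C. A i c * \<gamma> c\<bar>)"
    using full_column_rank_bound[OF C(1) rank] by blast
  \<comment> \<open>The summand for \<open>i\<close> is the factor by which the largest signed
    predictor dominates the absolute value of the \<open>i\<close>-th one, as \<open>abs_le\<close>
    shows below.\<close>
  define L where "L = (\<Sum>i<n. 1 + (\<Sum>k<n. e k) / e i)"
  have L: "L \<ge> 0" unfolding L_def using e by (intro sum_nonneg add_nonneg_nonneg divide_nonneg_pos) (auto intro: less_imp_le)
  show ?thesis
  \<comment> \<open>The summand 1 secures strict positivity, since \<open>K\<close> is only known to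
    be nonnegative.\<close>
  proof (intro exI[of _ "K * L + 1"] conjI allI)
    show "0 < K * L + 1" using K L by (simp add: add_nonneg_pos)
    fix \<gamma>
    define s where "s i = \<sigma> i * (\<Sum>c\<in>C. A i c * \<gamma> c)" for i
    have abs_s: "\<bar>\<Sum>c\<in>C. A i c * \<gamma> c\<bar> = \<bar>s i\<bar>" if "i < n" for i
      using sgn[OF that] by (simp add: s_def abs_mult)
    have "(\<Sum>i<n. e i * s i) = (\<Sum>i<n. \<Sum>c\<in>C. e i * (\<sigma> i * A i c) * \<gamma> c)"
      by (simp add: s_def sum_distrib_left mult.assoc)
    also have "\<dots> = (\<Sum>c\<in>C. (\<Sum>i<n. e i * (\<sigma> i * A i c)) * \<gamma> c)"
      by (subst sum.swap) (simp add: sum_distrib_right)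
    also have "\<dots> = 0" using bal by simp
    finally have es: "(\<Sum>i<n. e i * s i) = 0" .
    obtain i where i: "i < n" and max: "\<And>k. k < n \<Longrightarrow> s k \<le> s i"
      using ex_is_arg_min_if_finite[of "{..<n}" "\<lambda>i. - s i"] n
      by (auto simp: is_arg_min_linorder)
    have si: "0 \<le> s i"
    proof (rule ccontr)
      assume "\<not> 0 \<le> s i"
      then have "s k < 0" if "k < n" for k using max[OF that] by linarith
      then have "(\<Sum>k<n. e k * s k) < (\<Sum>k<n. 0)"
        using e n by (intro sum_strict_mono) (auto intro!: mult_pos_neg)
      then show False using es by simp
    qed
    \<comment> \<open>Since the weighted sum vanishes, \<open>- (e k * s k)\<close> equals the sum
      of the other terms, each of which is at most its weight times the maximum \<open>s i\<close>.
      This bounds \<open>s k\<close> from below; the choice of \<open>i\<close> bounds it from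
      above.\<close>
    have abs_le: "\<bar>s k\<bar> \<le> (1 + (\<Sum>l<n. e l) / e k) * s i" if k: "k < n" for k
    proof -
      have "- (e k * s k) = (\<Sum>l\<in>{..<n}-{k}. e l * s l)"
        using es k by (simp add: sum.remove[of _ k])
      also have "\<dots> \<le> (\<Sum>l\<in>{..<n}-{k}. e l * s i)"
        using max e by (intro sum_mono mult_left_mono) (auto intro: less_imp_le)
      also have "\<dots> \<le> (\<Sum>l<n. e l * s i)"
        using e si by (intro sum_mono2) (auto intro!: mult_nonneg_nonneg intro: less_imp_le)
      finally have "- s k \<le> (\<Sum>l<n. e l) / e k * s i"
        using e[OF k] by (simp add: field_simps sum_distrib_right sum_distrib_left)
      moreover have "0 \<le> (\<Sum>l<n. e l) / e k * s i"
        using e k si by (intro mult_nonneg_nonneg divide_nonneg_pos sum_nonneg) (auto intro: less_imp_le)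
      ultimately show ?thesis using max[OF k] si by (simp add: abs_le_iff algebra_simps)
    qed
    have "\<bar>\<gamma> c\<bar> \<le> (K * L + 1) * s i" if "c \<in> C" for c
    proof -
      have "\<bar>\<gamma> c\<bar> \<le> K * (\<Sum>k<n. \<bar>s k\<bar>)" using K(2)[OF that, of \<gamma>] abs_s by simp
      also have "\<dots> \<le> K * (L * s i)"
        unfolding L_def sum_distrib_right using K(1) abs_le by (intro mult_left_mono sum_mono) auto
      finally show ?thesis using si by (simp add: algebra_simps)
    qed
    then show "\<exists>i<n. 0 \<le> \<sigma> i * (\<Sum>c\<in>C. A i c * \<gamma> c) \<and>
           (\<forall>c\<in>C. \<bar>\<gamma> c\<bar> \<le> (K * L + 1) * (\<sigma> i * (\<Sum>c\<in>C. A i c * \<gamma> c)))"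
      using i si unfolding s_def by blast
  qed
qed

section \<open>The likelihood and a tail event of F\<close>

text \<open>All factors lie in [0,1], so every factor but the \<open>i\<close>-th may be dropped.
  That factor is the probability of \<open>d > s i\<close> if \<open>y i = 0\<close> and of
  \<open>d \<le> s i\<close> if \<open>y i = 1\<close>; either event implies that the signed
  predictor is at most \<open>\<bar>d\<bar>\<close>.\<close>

lemma likelihood_le_tail:
  fixes M :: "real measure" and s :: "nat \<Rightarrow> real" and y :: "nat \<Rightarrow> nat"
  assumes "real_distribution M" and y: "\<And>i. i < n \<Longrightarrow> y i \<le> 1" and i: "i < n"
  shows "(\<Prod>i<n. cdf M (s i) ^ y i * (1 - cdf M (s i)) ^ (1 - y i))
           \<le> measure M {d. (1 - 2 * real (y i)) * s i \<le> \<bar>d\<bar>}"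
proof -
  interpret real_distribution M by fact
  let ?f = "\<lambda>i. cdf M (s i) ^ y i * (1 - cdf M (s i)) ^ (1 - y i)"
  have 01: "0 \<le> cdf M t" "cdf M t \<le> 1" for t
    by (auto simp: cdf_nonneg cdf_bounded_prob)
  have f: "0 \<le> ?f i" "?f i \<le> 1" for i
    using 01 by (auto intro!: mult_nonneg_nonneg mult_le_one power_le_one)
  have "(\<Prod>i<n. ?f i) = ?f i * (\<Prod>i\<in>{..<n} - {i}. ?f i)"
    using i by (intro prod.remove) auto
  also have "\<dots> \<le> ?f i"
    using f by (intro mult_right_le_one_le prod_nonneg prod_le_1) auto
  also have "\<dots> \<le> measure M {d. (1 - 2 * real (y i)) * s i \<le> \<bar>d\<bar>}"
  proof (cases "y i = 0")
    case True
    have "1 - cdf M (s i) = measure M (space M - {..s i})"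
      unfolding cdf_def by (subst prob_compl) auto
    also have "\<dots> \<le> measure M {d. s i \<le> \<bar>d\<bar>}"
      by (intro finite_measure_mono) auto
    finally show ?thesis using True by simp
  next
    case False
    then have [simp]: "y i = 1" using y[OF i] by simp
    have "cdf M (s i) \<le> measure M {d. - s i \<le> \<bar>d\<bar>}"
      unfolding cdf_def by (intro finite_measure_mono) auto
    then show ?thesis by simp
  qed
  finally show ?thesis .
qed

section \<open>One-dimensional integrals of boxes, Gaussian and gamma kernels\<close>

text \<open>The radius is an argument because it will be \<open>K * \<bar>d\<bar>\<close> with
  \<open>d\<close> an integration variable, so that measurability in radius and point together is
  needed.\<close>

definition box_ind :: "real \<Rightarrow> real \<Rightarrow> ennreal" where
  "box_ind R w = (if \<bar>w\<bar> \<le> R then 1 else 0)"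

lemma borel_measurable_box_ind [measurable (raw)]:
  assumes [measurable]: "f \<in> borel_measurable N" "g \<in> borel_measurable N"
  shows "(\<lambda>x. box_ind (f x) (g x)) \<in> borel_measurable N"
  unfolding box_ind_def by measurable

lemma nn_integral_box_ind:
  assumes "0 \<le> R"
  shows "(\<integral>\<^sup>+w. box_ind R w \<partial>lborel) = ennreal (2 * R)"
proof -
  have "(\<integral>\<^sup>+w. box_ind R w \<partial>lborel) = (\<integral>\<^sup>+w. indicator {-R..R} w \<partial>lborel)"
    by (intro nn_integral_cong) (auto simp: box_ind_def indicator_def)
  then show ?thesis using assms by simp
qed

lemma nn_integral_lborel_shift:
  fixes f :: "real \<Rightarrow> ennreal"
  assumes "f \<in> borel_measurable borel"
  shows "(\<integral>\<^sup>+w. f (w + c) \<partial>lborel) = (\<integral>\<^sup>+w. f w \<partial>lborel)"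
  using nn_integral_real_affine[OF assms, of 1 c] by (simp add: add.commute)

lemma nn_integral_gaussian:
  fixes s :: real
  assumes s: "0 < s"
  shows "(\<integral>\<^sup>+w. ennreal (exp (- (s * w\<^sup>2))) \<partial>lborel) = ennreal (sqrt (pi / s))"
proof -
  \<comment> \<open>The standard deviation for which the exponent of the normal density is
    \<open>- (s * w\<^sup>2)\<close>.\<close>
  define \<sigma> where "\<sigma> = sqrt (1 / (2 * s))"
  have \<sigma>: "0 < \<sigma>" "\<sigma>\<^sup>2 = 1 / (2 * s)" using s by (auto simp: \<sigma>_def)
  have "exp (- (s * w\<^sup>2)) = sqrt (pi / s) * normal_density 0 \<sigma> w" for w
    using s unfolding normal_density_def \<sigma>(2) by (simp add: real_sqrt_divide field_simps)
  then have "(\<integral>\<^sup>+w. ennreal (exp (- (s * w\<^sup>2))) \<partial>lborel)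
      = (\<integral>\<^sup>+w. ennreal (sqrt (pi / s)) * ennreal (normal_density 0 \<sigma> w) \<partial>lborel)"
    using s by (simp add: ennreal_mult)
  also have "\<dots> = ennreal (sqrt (pi / s)) * (\<integral>\<^sup>+w. ennreal (normal_density 0 \<sigma> w) \<partial>lborel)"
    by (intro nn_integral_cmult) auto
  also have "(\<integral>\<^sup>+w. ennreal (normal_density 0 \<sigma> w) \<partial>lborel) = 1"
    using \<sigma> by (subst nn_integral_eq_integral) auto
  finally show ?thesis by simp
qed

text \<open>The substitution of \<open>b * \<tau>\<close> reduces the integral to the one that
  defines \<open>Gamma s\<close>, up to a power of \<open>b\<close>.\<close>

lemma nn_integral_gamma_kernel_finite:
  fixes b s :: real
  assumes b: "0 < b" and s: "0 < s"
  shows "(\<integral>\<^sup>+\<tau>. indicator {0<..} \<tau> * ennreal (\<tau> powr (s - 1) * exp (- \<tau> * b)) \<partial>lborel) < \<infinity>"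
proof -
  let ?f = "\<lambda>t::real. ennreal (indicator {0..} t * t powr (s - 1) / exp t)"
  have "ennreal (Gamma s) = ennreal b * (\<integral>\<^sup>+\<tau>. ?f (b * \<tau>) \<partial>lborel)"
    unfolding Gamma_conv_nn_integral_real[OF s]
    using b nn_integral_real_affine[of ?f b 0] by simp
  then have "ennreal b * (\<integral>\<^sup>+\<tau>. ?f (b * \<tau>) \<partial>lborel) < \<infinity>"
    by (metis ennreal_less_top infinity_ennreal_def)
  then have fin: "(\<integral>\<^sup>+\<tau>. ?f (b * \<tau>) \<partial>lborel) < \<infinity>"
    using b by (auto simp: ennreal_mult_less_top)
  have "(\<integral>\<^sup>+\<tau>. indicator {0<..} \<tau> * ennreal (\<tau> powr (s - 1) * exp (- \<tau> * b)) \<partial>lborel)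
     \<le> (\<integral>\<^sup>+\<tau>. ennreal (b powr (1 - s)) * ?f (b * \<tau>) \<partial>lborel)"
  proof (intro nn_integral_mono)
    fix \<tau> :: real
    show "indicator {0<..} \<tau> * ennreal (\<tau> powr (s - 1) * exp (- \<tau> * b))
       \<le> ennreal (b powr (1 - s)) * ?f (b * \<tau>)"
    proof (cases "\<tau> > 0")
      case True
      have "b powr (1 - s) * (b powr (s - 1)) = 1"
        using b by (simp flip: powr_add)
      then have "\<tau> powr (s - 1) * exp (- \<tau> * b)
          = b powr (1 - s) * ((b * \<tau>) powr (s - 1) / exp (b * \<tau>))"
        using True b by (simp add: powr_mult exp_minus field_simps)
      then show ?thesis using True b by (simp flip: ennreal_mult)
    qed simp
  qed
  also have "\<dots> = ennreal (b powr (1 - s)) * (\<integral>\<^sup>+\<tau>. ?f (b * \<tau>) \<partial>lborel)"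
    by (intro nn_integral_cmult) auto
  also have "\<dots> < \<infinity>" using fin by (auto simp: ennreal_mult_less_top)
  finally show ?thesis .
qed

text \<open>The first bound drops the exponential and is the good one for small \<open>s\<close>;
  the second drops the box and is the good one for large \<open>s\<close>.\<close>

lemma nn_integral_truncated_gaussian_le:
  assumes "0 \<le> R" "0 < s"
  shows "(\<integral>\<^sup>+w. box_ind R w * ennreal (exp (- (s * w\<^sup>2))) \<partial>lborel) \<le> ennreal (2 * R)"
    and "(\<integral>\<^sup>+w. box_ind R w * ennreal (exp (- (s * w\<^sup>2))) \<partial>lborel) \<le> ennreal (sqrt (pi / s))"
proof -
  have "(\<integral>\<^sup>+w. box_ind R w * ennreal (exp (- (s * w\<^sup>2))) \<partial>lborel) \<le> (\<integral>\<^sup>+w. box_ind R w \<partial>lborel)"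
    using assms by (intro nn_integral_mono) (auto simp: box_ind_def)
  then show "(\<integral>\<^sup>+w. box_ind R w * ennreal (exp (- (s * w\<^sup>2))) \<partial>lborel) \<le> ennreal (2 * R)"
    using nn_integral_box_ind assms by simp
  have "(\<integral>\<^sup>+w. box_ind R w * ennreal (exp (- (s * w\<^sup>2))) \<partial>lborel)
     \<le> (\<integral>\<^sup>+w. ennreal (exp (- (s * w\<^sup>2))) \<partial>lborel)"
    by (intro nn_integral_mono) (auto simp: box_ind_def)
  then show "(\<integral>\<^sup>+w. box_ind R w * ennreal (exp (- (s * w\<^sup>2))) \<partial>lborel) \<le> ennreal (sqrt (pi / s))"
    using nn_integral_gaussian assms by simp
qed

text \<open>This is the integral over one precision, with \<open>m\<close> the number of
  non-reference levels. The untruncated Gaussian integral is of order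
  \<open>\<tau> powr (-1/2)\<close> and lowers the exponent of \<open>\<tau>\<close> to
  \<open>m / 2 + a - 1\<close>. For \<open>b > 0\<close> the box bound leaves a convergent gamma
  integral times a multiple of \<open>R ^ m\<close>. For \<open>b = 0\<close> the range is split:
  the box bound is used near 0, where \<open>2 * a + m > 0\<close> gives convergence, and the
  Gaussian bound near infinity, where \<open>a < 0\<close> does.\<close>

lemma precision_integral_le:
  fixes a b \<kappa> :: real and m :: nat
  defines "f \<equiv> \<lambda>R \<tau>. indicator {0<..} \<tau> * (ennreal (\<tau> powr (real (Suc m) / 2 + a - 1) * exp (- \<tau> * b))
              * ((\<integral>\<^sup>+w. ennreal (exp (- (\<tau> / 4 * w\<^sup>2))) \<partial>lborel)
              * (\<integral>\<^sup>+w. box_ind R w * ennreal (exp (- (\<kappa> * \<tau> * w\<^sup>2))) \<partial>lborel) ^ m))"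
  assumes ab: "a < 0 \<and> b = 0 \<or> 0 < b" and am: "2 * a + real m > 0" and \<kappa>: "0 < \<kappa>"
  shows "\<exists>K\<ge>0. \<forall>R>0. (\<integral>\<^sup>+\<tau>. f R \<tau> \<partial>lborel)
           \<le> ennreal (K * R powr ((if b = 0 then - 2 * a else 0) + (if 0 < b then real m else 0)))"
proof -
  define c where "c = sqrt (4 * pi)"
  have c: "c \<ge> 0" by (simp add: c_def)
  let ?H = "\<lambda>R \<tau>. \<integral>\<^sup>+w. box_ind R w * ennreal (exp (- (\<kappa> * \<tau> * w\<^sup>2))) \<partial>lborel"
  \<comment> \<open>\<open>h\<close> is left open so that either bound on the truncated Gaussian
    integral can be inserted.\<close>
  have f_le: "f R \<tau> \<le> ennreal (c * h ^ m * (\<tau> powr (real m / 2 + a - 1) * exp (- \<tau> * b)))"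
    if "\<tau> > 0" "?H R \<tau> \<le> ennreal h" "h \<ge> 0" for R \<tau> h
  proof -
    have "(\<integral>\<^sup>+w. ennreal (exp (- (\<tau> / 4 * w\<^sup>2))) \<partial>lborel) = ennreal (c * \<tau> powr (-1/2))"
      using that by (subst nn_integral_gaussian)
        (auto simp: c_def powr_minus powr_half_sqrt real_sqrt_mult real_sqrt_divide field_simps)
    then have "f R \<tau> \<le> ennreal (\<tau> powr (real (Suc m) / 2 + a - 1) * exp (- \<tau> * b)) *
        (ennreal (c * \<tau> powr (-1/2)) * ennreal h ^ m)"
      unfolding f_def using that by (auto intro!: mult_left_mono power_mono)
    also have "\<dots> = ennreal ((\<tau> powr (real (Suc m) / 2 + a - 1) * exp (- \<tau> * b)) * ((c * \<tau> powr (-1/2)) * h ^ m))"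
      using that c by (simp add: ennreal_mult ennreal_power)
    also have "(\<tau> powr (real (Suc m) / 2 + a - 1) * exp (- \<tau> * b)) * ((c * \<tau> powr (-1/2)) * h ^ m)
       = c * h ^ m * ((\<tau> powr (real (Suc m) / 2 + a - 1) * \<tau> powr (-1/2)) * exp (- \<tau> * b))"
      by (simp add: mult_ac)
    also have "\<tau> powr (real (Suc m) / 2 + a - 1) * \<tau> powr (-1/2) = \<tau> powr (real m / 2 + a - 1)"
      unfolding powr_add[symmetric] by (rule arg_cong[where f = "(powr) \<tau>"]) (simp add: field_simps)
    finally show ?thesis .
  qed
  have f_0: "f R \<tau> = 0" if "\<not> \<tau> > 0" for R \<tau> using that by (simp add: f_def)
  show ?thesis
  proof (cases "0 < b")
    case True
    let ?g = "\<lambda>\<tau>::real. indicator {0<..} \<tau> * ennreal (\<tau> powr (real m / 2 + a - 1) * exp (- \<tau> * b))"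
    obtain K where K: "0 \<le> K" "(\<integral>\<^sup>+\<tau>. ?g \<tau> \<partial>lborel) = ennreal K"
      using nn_integral_gamma_kernel_finite[OF True, of "real m / 2 + a"] am
      by (cases "\<integral>\<^sup>+\<tau>. ?g \<tau> \<partial>lborel") auto
    show ?thesis
    proof (intro exI[of _ "c * 2 ^ m * K"] conjI allI impI)
      show "0 \<le> c * 2 ^ m * K" using K c by simp
      fix R :: real assume R: "R > 0"
      have "(\<integral>\<^sup>+\<tau>. f R \<tau> \<partial>lborel) \<le> (\<integral>\<^sup>+\<tau>. ennreal (c * (2 * R) ^ m) * ?g \<tau> \<partial>lborel)"
      proof (intro nn_integral_mono)
        fix \<tau> :: real
        show "f R \<tau> \<le> ennreal (c * (2 * R) ^ m) * ?g \<tau>"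
        proof (cases "\<tau> > 0")
          case True
          have "f R \<tau> \<le> ennreal (c * (2 * R) ^ m * (\<tau> powr (real m / 2 + a - 1) * exp (- \<tau> * b)))"
            using True R \<kappa> by (intro f_le nn_integral_truncated_gaussian_le) auto
          then show ?thesis using True c R by (simp add: ennreal_mult)
        qed (simp add: f_0)
      qed
      also have "\<dots> = ennreal (c * (2 * R) ^ m) * ennreal K"
        unfolding K(2)[symmetric] by (intro nn_integral_cmult) measurable
      also have "\<dots> = ennreal (c * 2 ^ m * K * R ^ m)"
        using c R K by (simp add: power_mult_distrib mult_ac flip: ennreal_mult)
      finally show "(\<integral>\<^sup>+\<tau>. f R \<tau> \<partial>lborel) \<le> ennreal (c * 2 ^ m * K *
          R powr ((if b = 0 then - 2 * a else 0) + (if 0 < b then real m else 0)))"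
        using True R by (simp add: powr_realpow)
    qed
  next
    case False
    then have b: "b = 0" and a: "a < 0" using ab by auto
    \<comment> \<open>\<open>D\<close> is the constant in the Gaussian bound, whose
      \<open>m\<close>-th power is \<open>D * \<tau> powr (- real m / 2)\<close>. The two summands
      of \<open>K\<close> come from the ranges below and above the splitting point.\<close>
    define D where "D = sqrt (pi / \<kappa>) ^ m"
    have D: "D \<ge> 0" unfolding D_def using \<kappa> by simp
    define K where "K = c * 2 ^ m / (real m / 2 + a) + c * D / (- a)"
    show ?thesis
    proof (intro exI[of _ K] conjI allI impI)
      have "0 < real m / 2 + a" using am by simp
      then have "0 \<le> c * 2 ^ m / (real m / 2 + a)" using c by (intro divide_nonneg_pos) auto
      moreover have "0 \<le> c * D / (- a)" using a c D by (intro divide_nonneg_pos) auto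
      ultimately show "0 \<le> K" unfolding K_def by (rule add_nonneg_nonneg)
      fix R :: real assume R: "R > 0"
      \<comment> \<open>At this point the box bound and the Gaussian bound are of the same order in
        \<open>R\<close>, and both pieces of the integral scale as
        \<open>R powr (- 2 * a)\<close>.\<close>
      define T where "T = R powr -2"
      have T: "T > 0" using R by (simp add: T_def)
      let ?g1 = "\<lambda>\<tau>::real. ennreal (\<tau> powr (real m / 2 + a - 1)) * indicator {0..T} \<tau>"
      let ?g2 = "\<lambda>\<tau>::real. ennreal (\<tau> powr (a - 1)) * indicator {T..} \<tau>"
      have g1: "(\<integral>\<^sup>+\<tau>. ?g1 \<tau> \<partial>lborel) = ennreal (T powr (real m / 2 + a) / (real m / 2 + a))"
        using has_integral_powr_from_0[of "real m / 2 + a - 1" T] am T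
        by (intro nn_integral_has_integral_lebesgue') auto
      have g2: "(\<integral>\<^sup>+\<tau>. ?g2 \<tau> \<partial>lborel) = ennreal (T powr a / - a)"
        using has_integral_powr_to_inf[of "a - 1" T] a T
        by (intro nn_integral_has_integral_lebesgue') auto
      have "(\<integral>\<^sup>+\<tau>. f R \<tau> \<partial>lborel)
         \<le> (\<integral>\<^sup>+\<tau>. ennreal (c * (2 * R) ^ m) * ?g1 \<tau> + ennreal (c * D) * ?g2 \<tau> \<partial>lborel)"
      proof (intro nn_integral_mono)
        fix \<tau> :: real
        consider "\<not> \<tau> > 0" | "0 < \<tau>" "\<tau> \<le> T" | "0 < \<tau>" "T \<le> \<tau>" by linarith
        then show "f R \<tau> \<le> ennreal (c * (2 * R) ^ m) * ?g1 \<tau> + ennreal (c * D) * ?g2 \<tau>"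
        proof cases
          case 1
          then show ?thesis by (simp add: f_0)
        next
          case 2
          have "f R \<tau> \<le> ennreal (c * (2 * R) ^ m * (\<tau> powr (real m / 2 + a - 1) * exp (- \<tau> * b)))"
            using 2 R \<kappa> by (intro f_le nn_integral_truncated_gaussian_le) auto
          also have "\<dots> = ennreal (c * (2 * R) ^ m) * ?g1 \<tau>"
            using 2 c R b by (simp add: ennreal_mult)
          finally show ?thesis by (rule order.trans) simp
        next
          case 3
          have "f R \<tau> \<le> ennreal (c * sqrt (pi / (\<kappa> * \<tau>)) ^ m * (\<tau> powr (real m / 2 + a - 1) * exp (- \<tau> * b)))"
            using 3 R \<kappa> by (intro f_le nn_integral_truncated_gaussian_le) auto
          also have "sqrt (pi / (\<kappa> * \<tau>)) ^ m = D * \<tau> powr (- real m / 2)"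
          proof -
            have "sqrt (pi / (\<kappa> * \<tau>)) = sqrt (pi / \<kappa>) * \<tau> powr (-1/2)"
              using 3 \<kappa> by (simp add: powr_minus powr_half_sqrt real_sqrt_mult real_sqrt_divide field_simps)
            moreover have "(\<tau> powr (-1/2)) ^ m = \<tau> powr (- real m / 2)"
              using 3 by (simp add: powr_realpow[symmetric] powr_powr)
            ultimately show ?thesis by (simp add: D_def power_mult_distrib)
          qed
          also have "c * (D * \<tau> powr (- real m / 2)) * (\<tau> powr (real m / 2 + a - 1) * exp (- \<tau> * b))
             = c * D * (\<tau> powr (- real m / 2) * \<tau> powr (real m / 2 + a - 1))"
            by (simp add: b mult_ac)
          also have "\<tau> powr (- real m / 2) * \<tau> powr (real m / 2 + a - 1) = \<tau> powr (a - 1)"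
            by (simp flip: powr_add)
          also have "ennreal (c * D * \<tau> powr (a - 1)) = ennreal (c * D) * ?g2 \<tau>"
            using 3 c D by (simp add: ennreal_mult)
          finally show ?thesis by (rule order.trans) simp
        qed
      qed
      also have "\<dots> = ennreal (c * (2 * R) ^ m) * ennreal (T powr (real m / 2 + a) / (real m / 2 + a))
          + ennreal (c * D) * ennreal (T powr a / - a)"
        by (subst nn_integral_add) (auto simp: nn_integral_cmult g1 g2)
      also have "\<dots> = ennreal (c * (2 * R) ^ m * (T powr (real m / 2 + a) / (real m / 2 + a)) + c * D * (T powr a / - a))"
      proof -
        have "0 \<le> T powr (real m / 2 + a) / (real m / 2 + a)" using am by auto
        moreover have "0 \<le> T powr a / - a" using a by (intro divide_nonneg_pos) auto
        moreover have "ennreal v * ennreal w + ennreal v' * ennreal w' = ennreal (v * w + v' * w')"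
          if "0 \<le> v" "0 \<le> w" "0 \<le> v'" "0 \<le> w'" for v w v' w'
          using that by (simp flip: ennreal_mult ennreal_plus)
        ultimately show ?thesis using c D R by (meson mult_nonneg_nonneg zero_le_power zero_le_numeral less_imp_le)
      qed
      also have "c * (2 * R) ^ m * (T powr (real m / 2 + a) / (real m / 2 + a)) + c * D * (T powr a / - a)
          = K * R powr (- 2 * a)"
      proof -
        have "R ^ m * T powr (real m / 2 + a) = R powr (real m + (- 2) * (real m / 2 + a))"
          unfolding T_def powr_powr powr_add[of R "real m"] using R by (simp only: powr_realpow)
        then have 1: "R ^ m * T powr (real m / 2 + a) = R powr (- 2 * a)" by (simp add: algebra_simps)
        have 2: "T powr a = R powr (- 2 * a)" by (simp add: T_def powr_powr)
        have "c * (2 * R) ^ m * (T powr (real m / 2 + a) / (real m / 2 + a))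
          = c * 2 ^ m / (real m / 2 + a) * (R ^ m * T powr (real m / 2 + a))"
          by (simp add: power_mult_distrib)
        then show ?thesis unfolding 1 2 K_def by (simp add: algebra_simps)
      qed
      finally show "(\<integral>\<^sup>+\<tau>. f R \<tau> \<partial>lborel) \<le> ennreal (K *
          R powr ((if b = 0 then - 2 * a else 0) + (if 0 < b then real m else 0)))"
        using b by simp
    qed
  qed
qed

section \<open>Integration over the random effects\<close>

text \<open>Each squared difference is at most twice the sum of the two squares. Dividing by
  \<open>4 * real m\<close> compensates for the repeated \<open>v 0\<close>, so the differences cost
  at most half of the total, and half of the square of \<open>v 0\<close> is still
  available.\<close>

lemma sum_squares_ge_first_and_differences:
  fixes v :: "nat \<Rightarrow> real"
  assumes m: "1 \<le> m"
  shows "(v 0)\<^sup>2 / 2 + (\<Sum>k\<in>{1..<m}. (v k - v 0)\<^sup>2) / (4 * real m) \<le> (\<Sum>k<m. (v k)\<^sup>2)"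
proof -
  define S where "S = (\<Sum>k\<in>{1..<m}. (v k)\<^sup>2)"
  have S: "S \<ge> 0" by (simp add: S_def sum_nonneg)
  have eq: "(\<Sum>k<m. (v k)\<^sup>2) = (v 0)\<^sup>2 + S"
    unfolding S_def lessThan_atLeast0 using m by (simp add: sum.atLeast_Suc_lessThan)
  have "(\<Sum>k\<in>{1..<m}. (v k - v 0)\<^sup>2) \<le> (\<Sum>k\<in>{1..<m}. 2 * (v k)\<^sup>2 + 2 * (v 0)\<^sup>2)"
  proof (intro sum_mono)
    fix k
    have "0 \<le> (v k + v 0)\<^sup>2" by simp
    then show "(v k - v 0)\<^sup>2 \<le> 2 * (v k)\<^sup>2 + 2 * (v 0)\<^sup>2"
      by (simp add: power2_sum power2_diff)
  qed
  also have "\<dots> = 2 * S + real (m - 1) * (2 * (v 0)\<^sup>2)"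
    by (simp add: S_def sum.distrib sum_distrib_left)
  also have "\<dots> \<le> 2 * real m * S + real m * (2 * (v 0)\<^sup>2)"
    using m S by (intro add_mono mult_right_mono) auto
  finally have "(\<Sum>k\<in>{1..<m}. (v k - v 0)\<^sup>2) / (4 * real m) \<le> ((v 0)\<^sup>2 + S) / 2"
    using m by (simp add: field_simps)
  then show ?thesis unfolding eq using S by simp
qed

text \<open>The previous lemma, multiplied by \<open>\<tau> j / 2\<close>, separates the exponent
  into reference levels and differences; this is the origin of the constants 1/4 and
  \<open>1 / (8 * real (q j))\<close>. Translation invariance then turns the differences into
  independent variables.\<close>

lemma random_effects_integral_le:
  fixes q :: "nat \<Rightarrow> nat" and \<tau> :: "nat \<Rightarrow> real"
  assumes q: "\<And>j. j < r \<Longrightarrow> 1 \<le> q j" and \<tau>: "\<And>j. j < r \<Longrightarrow> 0 < \<tau> j"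
  shows "(\<integral>\<^sup>+u. (\<Prod>j<r. ennreal (exp (- \<tau> j * ((1/2) * (\<Sum>k<q j. (u (j, k))\<^sup>2))))
            * (\<Prod>k\<in>{1..<q j}. box_ind R (u (j, k) - u (j, 0))))
          \<partial>(PiM (SIGMA j:{..<r}. {..<q j}) (\<lambda>_. lborel)))
    \<le> (\<Prod>j<r. (\<integral>\<^sup>+w. ennreal (exp (- (\<tau> j / 4 * w\<^sup>2))) \<partial>lborel)
            * (\<integral>\<^sup>+w. box_ind R w * ennreal (exp (- (1 / (8 * real (q j)) * \<tau> j * w\<^sup>2))) \<partial>lborel) ^ (q j - 1))"
proof -
  interpret product_sigma_finite "\<lambda>_::nat \<times> nat. lborel :: real measure"
    by unfold_locales
  \<comment> \<open>\<open>A\<close> indexes the reference levels and \<open>B\<close> all others,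
    so that the variables in \<open>B\<close> can be integrated first with those in \<open>A\<close>
    held fixed.\<close>
  define A where "A = (SIGMA j:{..<r}. {0::nat})"
  define B where "B = (SIGMA j:{..<r}. {1..<q j})"
  have AB: "A \<inter> B = {}" "finite A" "finite B" "(SIGMA j:{..<r}. {..<q j}) = A \<union> B"
    using q by (force simp: A_def B_def)+
  define g where "g j w = ennreal (exp (- (\<tau> j / 4 * w\<^sup>2)))" for j and w :: real
  define h where "h j w = box_ind R w * ennreal (exp (- (1 / (8 * real (q j)) * \<tau> j * w\<^sup>2)))" for j and w :: real
  have [measurable]: "g j \<in> borel_measurable borel" "h j \<in> borel_measurable borel" for j
    unfolding g_def h_def by measurable
  let ?F = "\<lambda>u. (\<Prod>c\<in>A. g (fst c) (u c)) * (\<Prod>c\<in>B. h (fst c) (u c - u (fst c, 0)))"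
  have le: "ennreal (exp (- \<tau> j * ((1/2) * (\<Sum>k<q j. (u (j, k))\<^sup>2)))) * (\<Prod>k\<in>{1..<q j}. box_ind R (u (j, k) - u (j, 0)))
      \<le> g j (u (j, 0)) * (\<Prod>k\<in>{1..<q j}. h j (u (j, k) - u (j, 0)))" if j: "j < r" for j and u :: "nat \<times> nat \<Rightarrow> real"
  proof -
    let ?E = "\<lambda>k. exp (- (1 / (8 * real (q j)) * \<tau> j * (u (j, k) - u (j, 0))\<^sup>2))"
    have "\<tau> j / 2 * ((u (j, 0))\<^sup>2 / 2 + (\<Sum>k\<in>{1..<q j}. (u (j, k) - u (j, 0))\<^sup>2) / (4 * real (q j)))
        \<le> \<tau> j / 2 * (\<Sum>k<q j. (u (j, k))\<^sup>2)"
      using sum_squares_ge_first_and_differences[OF q[OF j], of "\<lambda>k. u (j, k)"] \<tau>[OF j]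
      by (intro mult_left_mono) auto
    moreover have "\<tau> j / 2 * ((u (j, 0))\<^sup>2 / 2 + (\<Sum>k\<in>{1..<q j}. (u (j, k) - u (j, 0))\<^sup>2) / (4 * real (q j)))
        = \<tau> j / 4 * (u (j, 0))\<^sup>2 + (\<Sum>k\<in>{1..<q j}. 1 / (8 * real (q j)) * \<tau> j * (u (j, k) - u (j, 0))\<^sup>2)"
      unfolding sum_distrib_left[symmetric] using q[OF j] by (simp add: field_simps)
    ultimately have "exp (- \<tau> j * ((1/2) * (\<Sum>k<q j. (u (j, k))\<^sup>2)))
        \<le> exp (- (\<tau> j / 4 * (u (j, 0))\<^sup>2) + (\<Sum>k\<in>{1..<q j}. - (1 / (8 * real (q j)) * \<tau> j * (u (j, k) - u (j, 0))\<^sup>2)))"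
      by (simp add: sum_negf)
    also have "\<dots> = exp (- (\<tau> j / 4 * (u (j, 0))\<^sup>2)) * (\<Prod>k\<in>{1..<q j}. ?E k)"
      by (simp only: exp_add exp_sum finite_atLeastLessThan)
    finally have "ennreal (exp (- \<tau> j * ((1/2) * (\<Sum>k<q j. (u (j, k))\<^sup>2))))
       \<le> g j (u (j, 0)) * (\<Prod>k\<in>{1..<q j}. ennreal (?E k))"
      unfolding g_def by (simp add: prod_ennreal prod_nonneg flip: ennreal_mult)
    then have "ennreal (exp (- \<tau> j * ((1/2) * (\<Sum>k<q j. (u (j, k))\<^sup>2)))) * (\<Prod>k\<in>{1..<q j}. box_ind R (u (j, k) - u (j, 0)))
       \<le> g j (u (j, 0)) * (\<Prod>k\<in>{1..<q j}. ennreal (?E k)) * (\<Prod>k\<in>{1..<q j}. box_ind R (u (j, k) - u (j, 0)))"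
      by (intro mult_right_mono) auto
    also have "\<dots> = g j (u (j, 0)) * (\<Prod>k\<in>{1..<q j}. h j (u (j, k) - u (j, 0)))"
      by (simp add: h_def prod.distrib mult_ac)
    finally show ?thesis .
  qed
  have prodA: "(\<Prod>j<r. f (j, 0)) = (\<Prod>c\<in>A. f c)" for f :: "nat \<times> nat \<Rightarrow> ennreal"
    unfolding A_def by (subst prod.Sigma[symmetric, where g = "\<lambda>j k. f (j, k)", simplified]) auto
  have prodB: "(\<Prod>j<r. \<Prod>k\<in>{1..<q j}. f (j, k)) = (\<Prod>c\<in>B. f c)" for f :: "nat \<times> nat \<Rightarrow> ennreal"
    unfolding B_def by (subst prod.Sigma) (auto simp: case_prod_beta)
  have le_F: "(\<Prod>j<r. ennreal (exp (- \<tau> j * ((1/2) * (\<Sum>k<q j. (u (j, k))\<^sup>2))))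
            * (\<Prod>k\<in>{1..<q j}. box_ind R (u (j, k) - u (j, 0)))) \<le> ?F u" for u
  proof -
    have "(\<Prod>j<r. ennreal (exp (- \<tau> j * ((1/2) * (\<Sum>k<q j. (u (j, k))\<^sup>2))))
            * (\<Prod>k\<in>{1..<q j}. box_ind R (u (j, k) - u (j, 0))))
       \<le> (\<Prod>j<r. g j (u (j, 0)) * (\<Prod>k\<in>{1..<q j}. h j (u (j, k) - u (j, 0))))"
      using le by (intro prod_mono_ennreal) auto
    also have "\<dots> = ?F u"
      using prodA[of "\<lambda>c. g (fst c) (u c)"] prodB[of "\<lambda>c. h (fst c) (u c - u (fst c, 0))"]
      by (simp add: prod.distrib)
    finally show ?thesis .
  qed
  have memA: "(fst c, 0) \<in> A" if "c \<in> B" for c using that by (auto simp: A_def B_def)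
  have [measurable]: "?F \<in> borel_measurable (PiM (A \<union> B) (\<lambda>_. lborel))"
  proof -
    have comp: "(\<lambda>u. u c) \<in> borel_measurable (PiM (A \<union> B) (\<lambda>_. lborel))" if "c \<in> A \<union> B" for c
      using measurable_component_singleton[OF that, of "\<lambda>_. lborel"] by simp
    have diff: "(\<lambda>u. u c - u (fst c, 0)) \<in> borel_measurable (PiM (A \<union> B) (\<lambda>_. lborel))" if "c \<in> B" for c
      using that memA[OF that] by (intro borel_measurable_diff comp) auto
    show ?thesis
      by (intro borel_measurable_times_ennreal borel_measurable_prod_ennreal)
         (auto intro: measurable_compose[OF comp] measurable_compose[OF diff])
  qed
  have "(\<integral>\<^sup>+u. (\<Prod>j<r. ennreal (exp (- \<tau> j * ((1/2) * (\<Sum>k<q j. (u (j, k))\<^sup>2))))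
            * (\<Prod>k\<in>{1..<q j}. box_ind R (u (j, k) - u (j, 0))))
          \<partial>(PiM (SIGMA j:{..<r}. {..<q j}) (\<lambda>_. lborel))) \<le> (\<integral>\<^sup>+u. ?F u \<partial>(PiM (A \<union> B) (\<lambda>_. lborel)))"
    unfolding AB(4) by (intro nn_integral_mono le_F)
  also have "\<dots> = (\<integral>\<^sup>+x. (\<integral>\<^sup>+y. ?F (merge A B (x, y)) \<partial>(PiM B (\<lambda>_. lborel))) \<partial>(PiM A (\<lambda>_. lborel)))"
    using AB by (intro product_nn_integral_fold) auto
  \<comment> \<open>For fixed \<open>x\<close> the inner integral factorises over \<open>B\<close>,
    and shifting each variable by its reference value removes the dependence on
    \<open>x\<close>.\<close>
  also have "\<dots> = (\<integral>\<^sup>+x. (\<Prod>c\<in>A. g (fst c) (x c)) * (\<Prod>c\<in>B. \<integral>\<^sup>+w. h (fst c) w \<partial>lborel) \<partial>(PiM A (\<lambda>_. lborel)))"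
  proof (intro nn_integral_cong)
    fix x :: "nat \<times> nat \<Rightarrow> real"
    have "?F (merge A B (x, y)) = (\<Prod>c\<in>A. g (fst c) (x c)) * (\<Prod>c\<in>B. h (fst c) (y c - x (fst c, 0)))" for y
      using memA AB(1) by (intro arg_cong2[where f = "(*)"] prod.cong) (auto simp: merge_def)
    then have "(\<integral>\<^sup>+y. ?F (merge A B (x, y)) \<partial>(PiM B (\<lambda>_. lborel)))
       = (\<integral>\<^sup>+y. (\<Prod>c\<in>A. g (fst c) (x c)) * (\<Prod>c\<in>B. h (fst c) (y c - x (fst c, 0))) \<partial>(PiM B (\<lambda>_. lborel)))"
      by simp
    also have "\<dots> = (\<Prod>c\<in>A. g (fst c) (x c)) * (\<integral>\<^sup>+y. (\<Prod>c\<in>B. h (fst c) (y c - x (fst c, 0))) \<partial>(PiM B (\<lambda>_. lborel)))"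
      by (intro nn_integral_cmult) measurable
    also have "(\<integral>\<^sup>+y. (\<Prod>c\<in>B. h (fst c) (y c - x (fst c, 0))) \<partial>(PiM B (\<lambda>_. lborel)))
        = (\<Prod>c\<in>B. \<integral>\<^sup>+w. h (fst c) (w - x (fst c, 0)) \<partial>lborel)"
      using AB by (intro product_nn_integral_prod[where f = "\<lambda>c w. h (fst c) (w - x (fst c, 0))"]) auto
    also have "\<dots> = (\<Prod>c\<in>B. \<integral>\<^sup>+w. h (fst c) w \<partial>lborel)"
      using nn_integral_lborel_shift[of "h j" "- x (j, 0)" for j] by (intro prod.cong) auto
    finally show "(\<integral>\<^sup>+y. ?F (merge A B (x, y)) \<partial>(PiM B (\<lambda>_. lborel)))
       = (\<Prod>c\<in>A. g (fst c) (x c)) * (\<Prod>c\<in>B. \<integral>\<^sup>+w. h (fst c) w \<partial>lborel)" .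
  qed
  also have "\<dots> = (\<integral>\<^sup>+x. (\<Prod>c\<in>A. g (fst c) (x c)) \<partial>(PiM A (\<lambda>_. lborel))) * (\<Prod>c\<in>B. \<integral>\<^sup>+w. h (fst c) w \<partial>lborel)"
    by (intro nn_integral_multc) measurable
  also have "(\<integral>\<^sup>+x. (\<Prod>c\<in>A. g (fst c) (x c)) \<partial>(PiM A (\<lambda>_. lborel))) = (\<Prod>c\<in>A. \<integral>\<^sup>+w. g (fst c) w \<partial>lborel)"
    using AB by (intro product_nn_integral_prod[where f = "\<lambda>c. g (fst c)"]) auto
  also have "\<dots> * (\<Prod>c\<in>B. \<integral>\<^sup>+w. h (fst c) w \<partial>lborel)
     = (\<Prod>j<r. (\<integral>\<^sup>+w. g j w \<partial>lborel) * (\<integral>\<^sup>+w. h j w \<partial>lborel) ^ (q j - 1))"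
    by (simp add: prodA[symmetric] prodB[symmetric] prod.distrib)
  finally show ?thesis unfolding g_def h_def .
qed

section \<open>The reduced linear predictor and the bound on the likelihood\<close>

definition reduced_coeff ::
  "nat \<Rightarrow> (nat \<Rightarrow> real) \<Rightarrow> (nat \<times> nat \<Rightarrow> real) \<Rightarrow> nat + nat \<times> nat \<Rightarrow> real" where
  "reduced_coeff r \<beta> u c = (case c of
      Inl k \<Rightarrow> \<beta> k + (if k = 0 then \<Sum>j<r. u (j, 0) else 0)
    | Inr (j, k) \<Rightarrow> u (j, k) - u (j, 0))"

lemma finite_Wt_cols: "finite (Wt_cols p r q)"
  by (auto simp: Wt_cols_def)

text \<open>Each observation sits at one level of each effect, so its indicator columns select the
  single difference between that level and the reference. The reference values re-enter through the
  intercept column of ones.\<close>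

lemma lin_pred_eq_reduced:
  assumes "0 < p" "x i 0 = 1" "\<And>j. j < r \<Longrightarrow> lev j i < q j"
  shows "lin_pred p r x lev i \<beta> u = (\<Sum>c\<in>Wt_cols p r q. Wt x lev i c * reduced_coeff r \<beta> u c)"
proof -
  let ?f = "\<lambda>c. Wt x lev i c * reduced_coeff r \<beta> u c"
  have "(\<Sum>c\<in>Wt_cols p r q. ?f c) = (\<Sum>k<p. ?f (Inl k)) + (\<Sum>c\<in>(SIGMA j:{..<r}. {1..<q j}). ?f (Inr c))"
    unfolding Wt_cols_def by (subst sum.union_disjoint) (auto simp: sum.reindex)
  also have "(\<Sum>k<p. ?f (Inl k)) = (\<Sum>k<p. x i k * \<beta> k) + (\<Sum>k<p. if k = 0 then x i k * (\<Sum>j<r. u (j, 0)) else 0)"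
    unfolding sum.distrib[symmetric]
    by (intro sum.cong) (auto simp: Wt_def reduced_coeff_def algebra_simps)
  also have "(\<Sum>k<p. if k = 0 then x i k * (\<Sum>j<r. u (j, 0)) else 0) = (\<Sum>j<r. u (j, 0))"
    using assms by simp
  also have "(\<Sum>c\<in>(SIGMA j:{..<r}. {1..<q j}). ?f (Inr c)) = (\<Sum>j<r. \<Sum>k\<in>{1..<q j}. ?f (Inr (j, k)))"
    by (subst sum.Sigma) auto
  also have "\<dots> = (\<Sum>j<r. u (j, lev j i) - u (j, 0))"
  proof (intro sum.cong refl)
    fix j assume "j \<in> {..<r}"
    then have l: "lev j i < q j" using assms by simp
    have "(\<Sum>k\<in>{1..<q j}. ?f (Inr (j, k))) = (\<Sum>k\<in>{1..<q j}. if k = lev j i then u (j, k) - u (j, 0) else 0)"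
      by (intro sum.cong) (auto simp: Wt_def reduced_coeff_def)
    also have "\<dots> = u (j, lev j i) - u (j, 0)"
      \<comment> \<open>At the reference level no column matches, and the difference is zero as
        well.\<close>
      using l by (cases "lev j i = 0") auto
    finally show "(\<Sum>k\<in>{1..<q j}. ?f (Inr (j, k))) = u (j, lev j i) - u (j, 0)" .
  qed
  finally show ?thesis by (simp add: lin_pred_def sum_subtractf)
qed

text \<open>The controlling row depends on \<open>\<beta>\<close> and \<open>u\<close>, but the
  bound mentions only the uniform constant \<open>K\<close>. The majorant is thus a single integral
  over \<open>M\<close> of a product of boxes, suited to an exchange of integrals.\<close>

lemma likelihood_le_integral_box:
  assumes M: "real_distribution M"
    and p_pos: "0 < p"
    and intercept: "\<forall>i<n. x i 0 = 1"
    and levels: "\<forall>j<r. \<forall>i<n. lev j i < q j"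
    and y01: "\<forall>i<n. y i \<le> 1"
    and rank: "full_column_rank n (Wt_cols p r q) (Wt x lev)"
    and e: "\<forall>i<n. 0 < e i" "\<forall>c\<in>Wt_cols p r q. (\<Sum>i<n. e i * Wt_star x lev y i c) = 0"
  shows "\<exists>K>0. \<forall>\<beta> u.
    ennreal (\<Prod>i<n. cdf M (lin_pred p r x lev i \<beta> u) ^ y i
              * (1 - cdf M (lin_pred p r x lev i \<beta> u)) ^ (1 - y i))
    \<le> (\<integral>\<^sup>+d. (\<Prod>k<p. box_ind (K * \<bar>d\<bar>) (\<beta> k + (if k = 0 then \<Sum>j<r. u (j, 0) else 0)))
            * (\<Prod>j<r. \<Prod>k\<in>{1..<q j}. box_ind (K * \<bar>d\<bar>) (u (j, k) - u (j, 0))) \<partial>M)"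
proof -
  interpret M: real_distribution M by fact
  let ?C = "Wt_cols p r q" and ?\<sigma> = "\<lambda>i. 1 - 2 * real (y i)"
  have sgn: "\<bar>?\<sigma> i\<bar> = 1" if "i < n" for i
    using y01[rule_format, OF that] by (cases "y i = 0") auto
  have ne: "?C \<noteq> {}" using p_pos by (auto simp: Wt_cols_def)
  obtain K where K: "K > 0" and row: "\<And>\<gamma>. \<exists>i<n. 0 \<le> ?\<sigma> i * (\<Sum>c\<in>?C. Wt x lev i c * \<gamma> c) \<and>
           (\<forall>c\<in>?C. \<bar>\<gamma> c\<bar> \<le> K * (?\<sigma> i * (\<Sum>c\<in>?C. Wt x lev i c * \<gamma> c)))"
    using exists_row_controlling_coefficients[OF finite_Wt_cols ne rank, of ?\<sigma> e] sgn e
    unfolding Wt_star_def by blast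
  show ?thesis
  proof (intro exI[of _ K] conjI allI K)
    fix \<beta> u
    let ?\<gamma> = "reduced_coeff r \<beta> u" and ?s = "\<lambda>i. lin_pred p r x lev i \<beta> u"
    have s: "?s i = (\<Sum>c\<in>?C. Wt x lev i c * ?\<gamma> c)" if "i < n" for i
      using intercept levels p_pos that by (intro lin_pred_eq_reduced) auto
    obtain i where i: "i < n" and bound: "\<And>c. c \<in> ?C \<Longrightarrow> \<bar>?\<gamma> c\<bar> \<le> K * (?\<sigma> i * ?s i)"
      using row[of ?\<gamma>] s by auto
    have "ennreal (\<Prod>i<n. cdf M (?s i) ^ y i * (1 - cdf M (?s i)) ^ (1 - y i))
        \<le> ennreal (measure M {d. ?\<sigma> i * ?s i \<le> \<bar>d\<bar>})"
      using y01 i by (intro ennreal_leI likelihood_le_tail M) auto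
    also have "\<dots> = (\<integral>\<^sup>+d. indicator {d. ?\<sigma> i * ?s i \<le> \<bar>d\<bar>} d \<partial>M)"
      by (simp add: M.emeasure_eq_measure)
    also have "\<dots> \<le> (\<integral>\<^sup>+d. (\<Prod>k<p. box_ind (K * \<bar>d\<bar>) (\<beta> k + (if k = 0 then \<Sum>j<r. u (j, 0) else 0)))
            * (\<Prod>j<r. \<Prod>k\<in>{1..<q j}. box_ind (K * \<bar>d\<bar>) (u (j, k) - u (j, 0))) \<partial>M)"
    proof (intro nn_integral_mono)
      fix d :: real
      show "indicator {d. ?\<sigma> i * ?s i \<le> \<bar>d\<bar>} d \<le>
            (\<Prod>k<p. box_ind (K * \<bar>d\<bar>) (\<beta> k + (if k = 0 then \<Sum>j<r. u (j, 0) else 0)))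
            * (\<Prod>j<r. \<Prod>k\<in>{1..<q j}. box_ind (K * \<bar>d\<bar>) (u (j, k) - u (j, 0)))"
      proof (cases "?\<sigma> i * ?s i \<le> \<bar>d\<bar>")
        case True
        have le: "\<bar>?\<gamma> c\<bar> \<le> K * \<bar>d\<bar>" if "c \<in> ?C" for c
          using order.trans[OF bound[OF that] mult_left_mono[OF True, of K]] K by simp
        have "box_ind (K * \<bar>d\<bar>) (\<beta> k + (if k = 0 then \<Sum>j<r. u (j, 0) else 0)) = 1" if "k < p" for k
          using le[of "Inl k"] that by (simp add: box_ind_def reduced_coeff_def Wt_cols_def)
        moreover have "box_ind (K * \<bar>d\<bar>) (u (j, k) - u (j, 0)) = 1" if "j < r" "k \<in> {1..<q j}" for j k
          using le[of "Inr (j, k)"] that by (simp add: box_ind_def reduced_coeff_def Wt_cols_def image_iff)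
        ultimately show ?thesis by (simp add: indicator_def)
      qed simp
    qed
    finally show "ennreal (\<Prod>i<n. cdf M (?s i) ^ y i * (1 - cdf M (?s i)) ^ (1 - y i))
       \<le> (\<integral>\<^sup>+d. (\<Prod>k<p. box_ind (K * \<bar>d\<bar>) (\<beta> k + (if k = 0 then \<Sum>j<r. u (j, 0) else 0)))
            * (\<Prod>j<r. \<Prod>k\<in>{1..<q j}. box_ind (K * \<bar>d\<bar>) (u (j, k) - u (j, 0))) \<partial>M)" .
  qed
qed

section \<open>Successive integration over the fixed effects, the random effects, the precisions and
  F\<close>

theorem theorem1:
  fixes M :: "real measure"
    and n p r :: nat and q :: "nat \<Rightarrow> nat"
    and x :: "nat \<Rightarrow> nat \<Rightarrow> real" and lev :: "nat \<Rightarrow> nat \<Rightarrow> nat"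
    and y :: "nat \<Rightarrow> nat" and a b :: "nat \<Rightarrow> real"
  assumes F_cdf: "real_distribution M"
    and p_pos: "0 < p"
    and intercept: "\<forall>i<n. x i 0 = 1"
    and q_pos: "\<forall>j<r. 1 \<le> q j"
    and levels: "\<forall>j<r. \<forall>i<n. lev j i < q j"
    and y01: "\<forall>i<n. y i \<le> 1"
    and B1: "\<forall>j<r. (a j < 0 \<and> b j = 0 \<and> 2 \<le> q j) \<or> 0 < b j"
    and B2: "\<forall>j<r. 2 * a j + real (q j) - 1 > 0"
    and B3: "full_column_rank n (Wt_cols p r q) (Wt x lev)"
    and B4: "\<exists>e :: nat \<Rightarrow> real. (\<forall>i<n. 0 < e i) \<and>
               (\<forall>c\<in>Wt_cols p r q. (\<Sum>i<n. e i * Wt_star x lev y i c) = 0)"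
    and B5: "integrable M (\<lambda>d. \<bar>d\<bar> powr
               (real p + (\<Sum>j<r. (if b j = 0 then - 2 * a j else 0)
                                + (if 0 < b j then real (q j) - 1 else 0))))"
  shows "(\<integral>\<^sup>+ \<tau>. indicator {\<tau>. \<forall>j<r. 0 < \<tau> j} \<tau> *
            (\<integral>\<^sup>+ u. (\<integral>\<^sup>+ \<beta>. ennreal (post_integrand M n p r q x lev y a b \<beta> u \<tau>)
                 \<partial>(PiM {..<p} (\<lambda>_. lborel)))
              \<partial>(PiM (SIGMA j:{..<r}. {..<q j}) (\<lambda>_. lborel)))
          \<partial>(PiM {..<r} (\<lambda>_. lborel))) < \<infinity>"
proof -
  interpret M: real_distribution M by (rule F_cdf)
  interpret Pn: product_sigma_finite "\<lambda>_::nat. lborel :: real measure" by unfold_locales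
  interpret Pu: product_sigma_finite "\<lambda>_::nat \<times> nat. lborel :: real measure" by unfold_locales
  define U where "U = (SIGMA j:{..<r}. {..<q j})"
  have U: "finite U" "\<And>j. j < r \<Longrightarrow> (j, 0) \<in> U" "\<And>j k. j < r \<Longrightarrow> k < q j \<Longrightarrow> (j, k) \<in> U"
    using q_pos by (auto simp: U_def)
  let ?Np = "PiM {..<p} (\<lambda>_. lborel :: real measure)"
  let ?Nu = "PiM U (\<lambda>_. lborel :: real measure)"
  let ?Nr = "PiM {..<r} (\<lambda>_. lborel :: real measure)"
  interpret Np: sigma_finite_measure ?Np by (rule Pn.sigma_finite) simp
  interpret Nu: sigma_finite_measure ?Nu by (rule Pu.sigma_finite) (rule U(1))
  interpret Nr: sigma_finite_measure ?Nr by (rule Pn.sigma_finite) simp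
  \<comment> \<open>These permit moving the integral over \<open>M\<close> outside each of the three
    Lebesgue integrals in turn.\<close>
  interpret MNp: pair_sigma_finite M ?Np ..
  interpret MNu: pair_sigma_finite M ?Nu ..
  interpret MNr: pair_sigma_finite M ?Nr ..
  obtain e where e: "\<forall>i<n. 0 < e i" "\<forall>c\<in>Wt_cols p r q. (\<Sum>i<n. e i * Wt_star x lev y i c) = 0"
    using B4 by blast
  obtain K where K: "0 < K" and like: "\<And>\<beta> u.
    ennreal (\<Prod>i<n. cdf M (lin_pred p r x lev i \<beta> u) ^ y i
              * (1 - cdf M (lin_pred p r x lev i \<beta> u)) ^ (1 - y i))
    \<le> (\<integral>\<^sup>+d. (\<Prod>k<p. box_ind (K * \<bar>d\<bar>) (\<beta> k + (if k = 0 then \<Sum>j<r. u (j, 0) else 0)))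
            * (\<Prod>j<r. \<Prod>k\<in>{1..<q j}. box_ind (K * \<bar>d\<bar>) (u (j, k) - u (j, 0))) \<partial>M)"
    using likelihood_le_integral_box[OF F_cdf p_pos intercept levels y01 B3 e] by blast

  \<comment> \<open>The integrand is the likelihood times the factors \<open>\<pi>\<close> and
    \<open>E\<close>. \<open>X\<close> and \<open>V\<close> are the boxes that majorise the
    likelihood, for fixed effects and differences. \<open>R\<close> and \<open>H\<close> are what
    remains after integrating over \<open>\<beta>\<close> and, as an upper bound, over
    \<open>u\<close>.\<close>
  define \<pi> where "\<pi> j t = ennreal (t powr (real (q j) / 2 + a j - 1) * exp (- t * b j))" for j and t :: real
  define E where "E j t u = ennreal (exp (- t * ((1/2) * (\<Sum>k<q j. (u (j, k))\<^sup>2))))"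
    for j and t :: real and u :: "nat \<times> nat \<Rightarrow> real"
  define X where "X d \<beta> u = (\<Prod>k<p. box_ind (K * \<bar>d\<bar>) (\<beta> k + (if k = 0 then \<Sum>j<r. u (j, 0) else 0)))"
    for d :: real and \<beta> :: "nat \<Rightarrow> real" and u :: "nat \<times> nat \<Rightarrow> real"
  define V where "V j d u = (\<Prod>k\<in>{1..<q j}. box_ind (K * \<bar>d\<bar>) (u (j, k) - u (j, 0)))"
    for j and d :: real and u :: "nat \<times> nat \<Rightarrow> real"
  define H where "H j d t = (\<integral>\<^sup>+w. ennreal (exp (- (t / 4 * w\<^sup>2))) \<partial>lborel)
      * (\<integral>\<^sup>+w. box_ind (K * \<bar>d\<bar>) w * ennreal (exp (- (1 / (8 * real (q j)) * t * w\<^sup>2))) \<partial>lborel) ^ (q j - 1)"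
    for j and d t :: real
  define R where "R d = ennreal ((2 * (K * \<bar>d\<bar>)) ^ p)" for d :: real

  have [measurable]: "(\<lambda>u. u c) \<in> borel_measurable ?Nu" if "c \<in> U" for c
    using measurable_component_singleton[OF that, of "\<lambda>_. lborel"] by simp
  have [measurable]: "(\<lambda>\<beta>. \<beta> k) \<in> borel_measurable ?Np" if "k < p" for k
    using measurable_component_singleton[of k "{..<p}" "\<lambda>_. lborel"] that by simp
  have [measurable]: "(\<lambda>\<tau>. \<tau> j) \<in> borel_measurable ?Nr" if "j < r" for j
    using measurable_component_singleton[of j "{..<r}" "\<lambda>_. lborel"] that by simp
  have [measurable]: "(\<lambda>d::real. d) \<in> borel_measurable M" by simp
  have R_meas [measurable]: "R \<in> borel_measurable M" unfolding R_def by measurable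
  have X_meas [measurable]: "(\<lambda>z. X (fst z) (snd z) u) \<in> borel_measurable (M \<Otimes>\<^sub>M ?Np)" for u
    unfolding X_def
  proof (intro borel_measurable_prod_ennreal)
    fix k assume "k \<in> {..<p}"
    then have [measurable]: "(\<lambda>\<beta>. \<beta> k) \<in> borel_measurable ?Np" by measurable
    show "(\<lambda>z. box_ind (K * \<bar>fst z\<bar>) (snd z k + (if k = 0 then \<Sum>j<r. u (j, 0) else 0)))
        \<in> borel_measurable (M \<Otimes>\<^sub>M ?Np)" by measurable
  qed
  have V_meas [measurable]: "(\<lambda>z. \<Prod>j<r. V j (fst z) (snd z)) \<in> borel_measurable (M \<Otimes>\<^sub>M ?Nu)"
    unfolding V_def
  proof (intro borel_measurable_prod_ennreal)
    fix j k assume "j \<in> {..<r}" "k \<in> {1..<q j}"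
    then have [measurable]: "(\<lambda>u. u (j, k)) \<in> borel_measurable ?Nu" "(\<lambda>u. u (j, 0)) \<in> borel_measurable ?Nu"
      using U by auto
    show "(\<lambda>z. box_ind (K * \<bar>fst z\<bar>) (snd z (j, k) - snd z (j, 0))) \<in> borel_measurable (M \<Otimes>\<^sub>M ?Nu)"
      by measurable
  qed
  have E_meas [measurable]: "(\<lambda>u. \<Prod>j<r. E j (\<tau> j) u) \<in> borel_measurable ?Nu" for \<tau>
    unfolding E_def
  proof (intro borel_measurable_prod_ennreal)
    fix j assume "j \<in> {..<r}"
    then have "(\<lambda>u. \<Sum>k<q j. (u (j, k))\<^sup>2) \<in> borel_measurable ?Nu"
      using U by (intro borel_measurable_sum) auto
    then show "(\<lambda>u. ennreal (exp (- \<tau> j * ((1/2) * (\<Sum>k<q j. (u (j, k))\<^sup>2))))) \<in> borel_measurable ?Nu"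
      by measurable
  qed
  have H_meas [measurable]: "(\<lambda>z. H j (fst z) (snd z)) \<in> borel_measurable (M \<Otimes>\<^sub>M borel)" for j
    unfolding H_def by measurable
  have [measurable]: "\<pi> j \<in> borel_measurable borel" for j
    unfolding \<pi>_def by measurable

  \<comment> \<open>Only the intercept box involves \<open>u\<close>, through a translation that
    leaves Lebesgue measure invariant. The boxes for \<open>\<beta>\<close> therefore have volume
    \<open>R d\<close> for every \<open>u\<close>.\<close>
  have beta_step: "(\<integral>\<^sup>+\<beta>. ennreal (post_integrand M n p r q x lev y a b \<beta> u \<tau>) \<partial>?Np)
      \<le> (\<Prod>j<r. \<pi> j (\<tau> j)) * ((\<Prod>j<r. E j (\<tau> j) u) * (\<integral>\<^sup>+d. R d * (\<Prod>j<r. V j d u) \<partial>M))" for u \<tau>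
  proof -
    let ?L = "\<lambda>\<beta>. \<Prod>i<n. cdf M (lin_pred p r x lev i \<beta> u) ^ y i
              * (1 - cdf M (lin_pred p r x lev i \<beta> u)) ^ (1 - y i)"
    let ?c = "(\<Prod>j<r. \<pi> j (\<tau> j)) * (\<Prod>j<r. E j (\<tau> j) u)"
    have L: "0 \<le> ?L \<beta>" for \<beta>
      by (intro prod_nonneg) (auto intro!: mult_nonneg_nonneg simp: M.cdf_nonneg M.cdf_bounded_prob)
    have XV: "(\<lambda>(d, \<beta>). X d \<beta> u * (\<Prod>j<r. V j d u)) \<in> borel_measurable (M \<Otimes>\<^sub>M ?Np)"
      unfolding V_def case_prod_beta by measurable
    have "ennreal (post_integrand M n p r q x lev y a b \<beta> u \<tau>) = ennreal (?L \<beta>) * ?c" for \<beta>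
    proof -
      have "(\<Prod>j<r. \<tau> j powr (real (q j) / 2 + a j - 1)
              * exp (- \<tau> j * (b j + (1/2) * (\<Sum>k<q j. (u (j, k))\<^sup>2))))
         = (\<Prod>j<r. (\<tau> j powr (real (q j) / 2 + a j - 1) * exp (- \<tau> j * b j))
              * exp (- \<tau> j * ((1/2) * (\<Sum>k<q j. (u (j, k))\<^sup>2))))"
        by (intro prod.cong refl) (simp add: distrib_left exp_add[symmetric] mult.assoc)
      then show ?thesis
        unfolding post_integrand_def \<pi>_def E_def prod.distrib[symmetric]
        using L by (simp add: ennreal_mult prod_nonneg prod_ennreal flip: ennreal_mult)
    qed
    then have "(\<integral>\<^sup>+\<beta>. ennreal (post_integrand M n p r q x lev y a b \<beta> u \<tau>) \<partial>?Np)
       = (\<integral>\<^sup>+\<beta>. ennreal (?L \<beta>) * ?c \<partial>?Np)" by simp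
    also have "\<dots> \<le> (\<integral>\<^sup>+\<beta>. (\<integral>\<^sup>+d. X d \<beta> u * (\<Prod>j<r. V j d u) \<partial>M) * ?c \<partial>?Np)"
      unfolding X_def V_def by (intro nn_integral_mono mult_right_mono like) simp
    also have "\<dots> = (\<integral>\<^sup>+\<beta>. (\<integral>\<^sup>+d. X d \<beta> u * (\<Prod>j<r. V j d u) \<partial>M) \<partial>?Np) * ?c"
    proof (intro nn_integral_multc M.borel_measurable_nn_integral)
      show "(\<lambda>(\<beta>, d). X d \<beta> u * (\<Prod>j<r. V j d u)) \<in> borel_measurable (?Np \<Otimes>\<^sub>M M)"
        using measurable_pair_swap[OF XV] by (simp add: case_prod_beta)
    qed
    also have "(\<integral>\<^sup>+\<beta>. (\<integral>\<^sup>+d. X d \<beta> u * (\<Prod>j<r. V j d u) \<partial>M) \<partial>?Np)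
        = (\<integral>\<^sup>+d. (\<integral>\<^sup>+\<beta>. X d \<beta> u * (\<Prod>j<r. V j d u) \<partial>?Np) \<partial>M)"
      by (intro MNp.Fubini' XV)
    also have "\<dots> = (\<integral>\<^sup>+d. R d * (\<Prod>j<r. V j d u) \<partial>M)"
    proof (intro nn_integral_cong)
      fix d :: real
      let ?f = "\<lambda>k w. box_ind (K * \<bar>d\<bar>) (w + (if k = 0 then \<Sum>j<r. u (j, 0) else 0))"
      have "(\<integral>\<^sup>+\<beta>. X d \<beta> u \<partial>?Np) = (\<Prod>k<p. \<integral>\<^sup>+w. ?f k w \<partial>lborel)"
        unfolding X_def by (intro Pn.product_nn_integral_prod[where f = ?f]) auto
      also have "\<dots> = (\<Prod>k<p. ennreal (2 * (K * \<bar>d\<bar>)))"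
        using K by (intro prod.cong refl) (subst nn_integral_lborel_shift; simp add: nn_integral_box_ind)
      also have "\<dots> = R d"
        using K by (simp add: R_def ennreal_power)
      finally have "(\<integral>\<^sup>+\<beta>. X d \<beta> u \<partial>?Np) = R d" .
      moreover have "(\<integral>\<^sup>+\<beta>. X d \<beta> u * (\<Prod>j<r. V j d u) \<partial>?Np) = (\<integral>\<^sup>+\<beta>. X d \<beta> u \<partial>?Np) * (\<Prod>j<r. V j d u)"
        unfolding X_def by (intro nn_integral_multc) measurable
      ultimately show "(\<integral>\<^sup>+\<beta>. X d \<beta> u * (\<Prod>j<r. V j d u) \<partial>?Np) = R d * (\<Prod>j<r. V j d u)"
        by simp
    qed
    finally show ?thesis by (simp add: mult_ac)
  qed

  \<comment> \<open>Positivity of the precisions is required by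
    \<open>random_effects_integral_le\<close>; in the full integral the indicator of the positive
    orthant supplies it.\<close>
  have u_step: "(\<integral>\<^sup>+u. (\<integral>\<^sup>+\<beta>. ennreal (post_integrand M n p r q x lev y a b \<beta> u \<tau>) \<partial>?Np) \<partial>?Nu)
      \<le> (\<integral>\<^sup>+d. R d * (\<Prod>j<r. \<pi> j (\<tau> j) * H j d (\<tau> j)) \<partial>M)" if \<tau>: "\<And>j. j < r \<Longrightarrow> 0 < \<tau> j" for \<tau>
  proof -
    let ?E = "\<lambda>u. \<Prod>j<r. E j (\<tau> j) u" and ?V = "\<lambda>d u. \<Prod>j<r. V j d u" and ?\<pi> = "\<Prod>j<r. \<pi> j (\<tau> j)"
    have "(\<integral>\<^sup>+u. (\<integral>\<^sup>+\<beta>. ennreal (post_integrand M n p r q x lev y a b \<beta> u \<tau>) \<partial>?Np) \<partial>?Nu)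
       \<le> (\<integral>\<^sup>+u. ?\<pi> * (?E u * (\<integral>\<^sup>+d. R d * ?V d u \<partial>M)) \<partial>?Nu)"
      by (intro nn_integral_mono beta_step)
    also have "\<dots> = (\<integral>\<^sup>+u. (\<integral>\<^sup>+d. ?\<pi> * (?E u * (R d * ?V d u)) \<partial>M) \<partial>?Nu)"
      unfolding V_def by (intro nn_integral_cong) (simp add: nn_integral_cmult)
    also have "\<dots> = (\<integral>\<^sup>+d. (\<integral>\<^sup>+u. ?\<pi> * (?E u * (R d * ?V d u)) \<partial>?Nu) \<partial>M)"
      by (intro MNu.Fubini') (simp add: case_prod_beta)
    also have "\<dots> \<le> (\<integral>\<^sup>+d. R d * (\<Prod>j<r. \<pi> j (\<tau> j) * H j d (\<tau> j)) \<partial>M)"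
    proof (intro nn_integral_mono)
      fix d :: real
      have [measurable]: "?V d \<in> borel_measurable ?Nu"
        using measurable_compose[OF measurable_Pair1' V_meas, of d] by simp
      have "(\<integral>\<^sup>+u. ?\<pi> * (?E u * (R d * ?V d u)) \<partial>?Nu) = (\<integral>\<^sup>+u. (?\<pi> * R d) * (\<Prod>j<r. E j (\<tau> j) u * V j d u) \<partial>?Nu)"
        by (simp add: prod.distrib mult_ac)
      also have "\<dots> = (?\<pi> * R d) * (\<integral>\<^sup>+u. (\<Prod>j<r. E j (\<tau> j) u * V j d u) \<partial>?Nu)"
        unfolding prod.distrib by (intro nn_integral_cmult) measurable
      also have "\<dots> \<le> (?\<pi> * R d) * (\<Prod>j<r. H j d (\<tau> j))"
        unfolding E_def V_def H_def U_def using q_pos \<tau>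
        by (intro mult_left_mono random_effects_integral_le) auto
      also have "\<dots> = R d * (\<Prod>j<r. \<pi> j (\<tau> j) * H j d (\<tau> j))"
        by (simp add: prod.distrib mult_ac)
      finally show "(\<integral>\<^sup>+u. ?\<pi> * (?E u * (R d * ?V d u)) \<partial>?Nu) \<le> R d * (\<Prod>j<r. \<pi> j (\<tau> j) * H j d (\<tau> j))" .
    qed
    finally show ?thesis .
  qed

  \<comment> \<open>The indicator is distributed over the factors, so that the integral over all
    precisions splits into one-dimensional ones.\<close>
  define f where "f j d t = indicator {0<..} t * (\<pi> j t * H j d t)" for j and d t :: real
  have f_meas [measurable]: "(\<lambda>z. f j (fst z) (snd z)) \<in> borel_measurable (M \<Otimes>\<^sub>M borel)" for j
    unfolding f_def by measurable
  have tau_step: "(\<integral>\<^sup>+\<tau>. indicator {\<tau>. \<forall>j<r. 0 < \<tau> j} \<tau> *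
            (\<integral>\<^sup>+u. (\<integral>\<^sup>+\<beta>. ennreal (post_integrand M n p r q x lev y a b \<beta> u \<tau>) \<partial>?Np) \<partial>?Nu) \<partial>?Nr)
      \<le> (\<integral>\<^sup>+d. R d * (\<Prod>j<r. \<integral>\<^sup>+t. f j d t \<partial>lborel) \<partial>M)"
  proof -
    have "(\<integral>\<^sup>+\<tau>. indicator {\<tau>. \<forall>j<r. 0 < \<tau> j} \<tau> *
            (\<integral>\<^sup>+u. (\<integral>\<^sup>+\<beta>. ennreal (post_integrand M n p r q x lev y a b \<beta> u \<tau>) \<partial>?Np) \<partial>?Nu) \<partial>?Nr)
       \<le> (\<integral>\<^sup>+\<tau>. (\<integral>\<^sup>+d. R d * (\<Prod>j<r. f j d (\<tau> j)) \<partial>M) \<partial>?Nr)"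
    proof (intro nn_integral_mono)
      fix \<tau> :: "nat \<Rightarrow> real"
      show "indicator {\<tau>. \<forall>j<r. 0 < \<tau> j} \<tau> *
            (\<integral>\<^sup>+u. (\<integral>\<^sup>+\<beta>. ennreal (post_integrand M n p r q x lev y a b \<beta> u \<tau>) \<partial>?Np) \<partial>?Nu)
         \<le> (\<integral>\<^sup>+d. R d * (\<Prod>j<r. f j d (\<tau> j)) \<partial>M)"
      proof (cases "\<forall>j<r. 0 < \<tau> j")
        case True
        then show ?thesis using u_step[of \<tau>] by (simp add: f_def)
      qed simp
    qed
    also have "\<dots> = (\<integral>\<^sup>+d. (\<integral>\<^sup>+\<tau>. R d * (\<Prod>j<r. f j d (\<tau> j)) \<partial>?Nr) \<partial>M)"
    proof (intro MNr.Fubini')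
      have "(\<lambda>z. \<Prod>j<r. f j (fst z) (snd z j)) \<in> borel_measurable (M \<Otimes>\<^sub>M ?Nr)"
      proof (intro borel_measurable_prod_ennreal)
        fix j assume "j \<in> {..<r}"
        then have [measurable]: "(\<lambda>\<tau>. \<tau> j) \<in> borel_measurable ?Nr" by measurable
        show "(\<lambda>z. f j (fst z) (snd z j)) \<in> borel_measurable (M \<Otimes>\<^sub>M ?Nr)"
          using measurable_compose[of "\<lambda>z. (fst z, snd z j)" "M \<Otimes>\<^sub>M ?Nr" "M \<Otimes>\<^sub>M borel", OF _ f_meas[of j]]
          by simp
      qed
      then show "(\<lambda>(d, \<tau>). R d * (\<Prod>j<r. f j d (\<tau> j))) \<in> borel_measurable (M \<Otimes>\<^sub>M ?Nr)"
        unfolding case_prod_beta by measurable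
    qed
    also have "\<dots> = (\<integral>\<^sup>+d. R d * (\<Prod>j<r. \<integral>\<^sup>+t. f j d t \<partial>lborel) \<partial>M)"
    proof (intro nn_integral_cong)
      fix d :: real
      have [measurable]: "f j d \<in> borel_measurable borel" for j
        using measurable_compose[OF measurable_Pair1' f_meas, of d] by simp
      have "(\<integral>\<^sup>+\<tau>. R d * (\<Prod>j<r. f j d (\<tau> j)) \<partial>?Nr) = R d * (\<integral>\<^sup>+\<tau>. (\<Prod>j<r. f j d (\<tau> j)) \<partial>?Nr)"
        by (intro nn_integral_cmult) measurable
      also have "(\<integral>\<^sup>+\<tau>. (\<Prod>j<r. f j d (\<tau> j)) \<partial>?Nr) = (\<Prod>j<r. \<integral>\<^sup>+t. f j d t \<partial>lborel)"
        by (intro Pn.product_nn_integral_prod[where f = "\<lambda>j. f j d"]) auto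
      finally show "(\<integral>\<^sup>+\<tau>. R d * (\<Prod>j<r. f j d (\<tau> j)) \<partial>?Nr) = R d * (\<Prod>j<r. \<integral>\<^sup>+t. f j d t \<partial>lborel)" .
    qed
    finally show ?thesis .
  qed

  define T where "T j = (if b j = 0 then - 2 * a j else 0) + (if 0 < b j then real (q j) - 1 else 0)" for j
  \<comment> \<open>\<open>precision_integral_le\<close> is used with \<open>m = q j - 1\<close> and
    radius \<open>K * \<bar>d\<bar>\<close>, which is positive only for nonzero
    \<open>d\<close>.\<close>
  have "\<exists>C\<ge>0. \<forall>d. d \<noteq> 0 \<longrightarrow> (\<integral>\<^sup>+t. f j d t \<partial>lborel) \<le> ennreal (C * (K * \<bar>d\<bar>) powr T j)" if j: "j < r" for j
  proof -
    have q1: "1 \<le> q j" using q_pos j by simp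
    then have q: "Suc (q j - 1) = q j" "real (q j - 1) = real (q j) - 1" by (auto simp: of_nat_diff)
    have ab: "a j < 0 \<and> b j = 0 \<or> 0 < b j" using B1 j by auto
    have am: "2 * a j + real (q j - 1) > 0" using B2 j q(2) by (auto simp: algebra_simps)
    have \<kappa>: "0 < 1 / (8 * real (q j))" using q1 by simp
    obtain C where "C \<ge> 0" "\<forall>R>0. (\<integral>\<^sup>+t. indicator {0<..} t * (ennreal (t powr (real (Suc (q j - 1)) / 2 + a j - 1) * exp (- t * b j))
              * ((\<integral>\<^sup>+w. ennreal (exp (- (t / 4 * w\<^sup>2))) \<partial>lborel)
              * (\<integral>\<^sup>+w. box_ind R w * ennreal (exp (- (1 / (8 * real (q j)) * t * w\<^sup>2))) \<partial>lborel) ^ (q j - 1))) \<partial>lborel)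
      \<le> ennreal (C * R powr ((if b j = 0 then - 2 * a j else 0) + (if 0 < b j then real (q j - 1) else 0)))"
      using precision_integral_le[OF ab am \<kappa>] by blast
    then show ?thesis
      unfolding q f_def \<pi>_def H_def T_def using K by (intro exI[of _ C]) auto
  qed
  then obtain C where C: "\<And>j. j < r \<Longrightarrow> 0 \<le> C j"
    "\<And>j d. j < r \<Longrightarrow> d \<noteq> 0 \<Longrightarrow> (\<integral>\<^sup>+t. f j d t \<partial>lborel) \<le> ennreal (C j * (K * \<bar>d\<bar>) powr T j)"
    by metis
  define C' where "C' = 2 ^ p * (\<Prod>j<r. C j) * K powr (real p + (\<Sum>j<r. T j))"
  have d_bound: "R d * (\<Prod>j<r. \<integral>\<^sup>+t. f j d t \<partial>lborel) \<le> ennreal (C' * \<bar>d\<bar> powr (real p + (\<Sum>j<r. T j)))" for d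
  proof (cases "d = 0")
    \<comment> \<open>As \<open>p\<close> is positive, \<open>R 0 = 0\<close>; in
      \<open>ennreal\<close> this annihilates the product, whatever the value of the other
      factors.\<close>
    case True
    then show ?thesis using p_pos by (simp add: R_def)
  next
    case False
    define w where "w = K * \<bar>d\<bar>"
    have w: "w > 0" using K False by (simp add: w_def)
    have "R d * (\<Prod>j<r. \<integral>\<^sup>+t. f j d t \<partial>lborel) \<le> R d * (\<Prod>j<r. ennreal (C j * w powr T j))"
      unfolding w_def using C(2) False by (intro mult_left_mono prod_mono_ennreal) auto
    also have "\<dots> = ennreal ((2 * w) ^ p * (\<Prod>j<r. C j * w powr T j))"
    proof -
      have nonneg: "0 \<le> C j * w powr T j" if "j < r" for j using C(1)[OF that] by simp
      then show ?thesis
        using w by (subst prod_ennreal) (auto simp: R_def w_def[symmetric] ennreal_mult')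
    qed
    also have "(2 * w) ^ p * (\<Prod>j<r. C j * w powr T j) = 2 ^ p * (\<Prod>j<r. C j) * w powr (real p + (\<Sum>j<r. T j))"
      using w by (simp add: power_mult_distrib prod.distrib powr_add powr_realpow powr_sum mult_ac)
    also have "\<dots> = C' * \<bar>d\<bar> powr (real p + (\<Sum>j<r. T j))"
      using K by (simp add: C'_def w_def powr_mult mult_ac)
    finally show ?thesis .
  qed
  have "(\<integral>\<^sup>+d. R d * (\<Prod>j<r. \<integral>\<^sup>+t. f j d t \<partial>lborel) \<partial>M)
      \<le> (\<integral>\<^sup>+d. ennreal (C' * \<bar>d\<bar> powr (real p + (\<Sum>j<r. T j))) \<partial>M)"
    by (intro nn_integral_mono d_bound)
  also have "\<dots> < \<infinity>"
  proof -
    \<comment> \<open>The exponents \<open>T j\<close> add up to t, so this is exactly the moment of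
      order p + t in (B5).\<close>
    have "integrable M (\<lambda>d. C' * \<bar>d\<bar> powr (real p + (\<Sum>j<r. T j)))"
      using B5 unfolding T_def by (intro integrable_mult_right)
    moreover have "0 \<le> C'" unfolding C'_def using C(1) by (intro mult_nonneg_nonneg prod_nonneg) auto
    ultimately show ?thesis by (subst nn_integral_eq_integral) auto
  qed
  finally show ?thesis
    using tau_step unfolding U_def by (rule order.strict_trans1[rotated])
qed

end
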